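(* Let $n\ge1$, $0<s<1$, and let $u\in C^{2s+\epsilon,s+\epsilon}_{x,\,t,\,{\rm loc}}(\mathbb{R}^n\times\mathbb{R})$ (for some $\epsilon>0$) be a bounded solution of $$(\partial_t-\Delta)^s u(x,t)=0,\qquad (x,t)\in\mathbb{R}^n\times\mathbb{R}.$$ Then $u$ is constant.
   Context: For $0<s<1$, the fully fractional heat operator is defined pointwise by $$(\partial_t-\Delta)^s u(x,t):=C_{n,s}\int_{-\infty}^{t}\int_{\mathbb{R}^n}\frac{u(x,t)-u(y,\tau)}{(t-\tau)^{\frac n2+1+s}}e^{-\frac{|x-y|^2}{4(t-\tau)}}\,dy\,d\tau,\qquad C_{n,s}=\frac{1}{(4\pi)^{n/2}|\Gamma(-s)|},$$ with the $y$-integral taken in the Cauchy principal value sense. The parabolic Hölder space $C^{2\alpha,\alpha}_{x,t}$: for $0<\alpha\le\frac12$, $|u(x,t)-u(y,\tau)|\le C(|x-y|+|t-\tau|^{1/2})^{2\alpha}$; for $\frac12<\alpha\le1$, $u$ is $\alpha$-Hölder in $t$ uniformly in $x$ and $\nabla_x u$ is $(2\alpha-1)$-Hölder in $x$ uniformly in $t$ and $(\alpha-\frac12)$-Hölder in $t$ uniformly in $x$; for $\alpha>1$, $\partial_t u, D_x^2u\in C^{2\alpha-2,\alpha-1}_{x,t}$; "loc" means these hold locally. *)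

theory Defs
  imports "HOL-Analysis.Analysis"
begin

definition frac_heat_const :: "real \<Rightarrow> real \<Rightarrow> real" where
  "frac_heat_const n s = 1 / ((4 * pi) powr (n / 2) * \<bar>Gamma (- s)\<bar>)"

definition frac_heat :: "real \<Rightarrow> ('a::euclidean_space \<Rightarrow> real \<Rightarrow> real) \<Rightarrow> 'a \<Rightarrow> real \<Rightarrow> real" where
  "frac_heat s u x t =
     frac_heat_const (real DIM('a)) s *
     (LINT \<tau>:{..<t}|lborel.
        Lim (at_right (0::real))
          (\<lambda>\<delta>. LINT y:{y. \<delta> < dist y x}|lborel.
              (u x t - u y \<tau>) / (t - \<tau>) powr (real DIM('a) / 2 + 1 + s)
                * exp (- (norm (x - y))\<^sup>2 / (4 * (t - \<tau>)))))"

definition hoelder_base :: "real \<Rightarrow> ('a::euclidean_space \<Rightarrow> real \<Rightarrow> real) \<Rightarrow> bool" where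
  "hoelder_base \<alpha> u =
    (if \<alpha> \<le> 1/2 then
       (\<forall>K::('a \<times> real) set. compact K \<longrightarrow>
          (\<exists>C. \<forall>(x,t)\<in>K. \<forall>(y,\<tau>)\<in>K.
             \<bar>u x t - u y \<tau>\<bar> \<le> C * (norm (x - y) + sqrt \<bar>t - \<tau>\<bar>) powr (2 * \<alpha>)))
     else
       (\<exists>Du :: 'a \<Rightarrow> real \<Rightarrow> 'a.
          (\<forall>x t. ((\<lambda>y. u y t) has_derivative (\<lambda>h. Du x t \<bullet> h)) (at x)) \<and>
          (\<forall>K::('a \<times> real) set. compact K \<longrightarrow>
             (\<exists>C. (\<forall>x t \<tau>. (x,t) \<in> K \<longrightarrow> (x,\<tau>) \<in> K \<longrightarrow>
                     \<bar>u x t - u x \<tau>\<bar> \<le> C * \<bar>t - \<tau>\<bar> powr \<alpha> \<and>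
                     norm (Du x t - Du x \<tau>) \<le> C * \<bar>t - \<tau>\<bar> powr (\<alpha> - 1/2)) \<and>
                  (\<forall>x y t. (x,t) \<in> K \<longrightarrow> (y,t) \<in> K \<longrightarrow>
                     norm (Du x t - Du y t) \<le> C * norm (x - y) powr (2 * \<alpha> - 1))))))"

text \<open>Level k: \<alpha> \<in> (k, k+1]; for \<alpha> > 1, \<partial>_t u and D_x^2 u lie in C^{2\<alpha>-2,\<alpha>-1}_loc.\<close>
fun hoelder_lev :: "nat \<Rightarrow> real \<Rightarrow> ('a::euclidean_space \<Rightarrow> real \<Rightarrow> real) \<Rightarrow> bool" where
  "hoelder_lev 0 \<alpha> u = (0 < \<alpha> \<and> \<alpha> \<le> 1 \<and> hoelder_base \<alpha> u)"
| "hoelder_lev (Suc k) \<alpha> u =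
     (\<exists>(ut :: 'a \<Rightarrow> real \<Rightarrow> real) (Du :: 'a \<Rightarrow> real \<Rightarrow> 'a) (D2 :: 'a \<Rightarrow> real \<Rightarrow> 'a \<Rightarrow> 'a).
        (\<forall>x t. ((\<lambda>\<tau>. u x \<tau>) has_real_derivative ut x t) (at t)) \<and>
        (\<forall>x t. ((\<lambda>y. u y t) has_derivative (\<lambda>h. Du x t \<bullet> h)) (at x)) \<and>
        (\<forall>x t. ((\<lambda>y. Du y t) has_derivative D2 x t) (at x)) \<and>
        hoelder_lev k (\<alpha> - 1) ut \<and>
        (\<forall>b\<in>Basis. \<forall>c\<in>Basis. hoelder_lev k (\<alpha> - 1) (\<lambda>x t. D2 x t b \<bullet> c)))"

definition hoelder_loc :: "real \<Rightarrow> ('a::euclidean_space \<Rightarrow> real \<Rightarrow> real) \<Rightarrow> bool" where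
  "hoelder_loc \<alpha> u = hoelder_lev (nat (\<lceil>\<alpha>\<rceil> - 1)) \<alpha> u"

end

theory Submission
  imports Defs "HOL-Probability.Distributions"
begin

text \<open>Mollifying \<open>u\<close> in space-time by a compactly supported kernel preserves the equation, because the
  Hoelder constants are uniform on compact sets, and yields a solution \<open>v\<close> with global Lipschitz and
  second difference bounds. For a vector \<open>H\<close> pointing into the past let \<open>d X = v (X + H) - v X\<close>. If
  \<open>S = sup d > 0\<close> then, since \<open>d\<close> solves the same equation and the Gaussian kernel is positive,
  \<open>d\<close> is close to \<open>S\<close> at \<open>X + H\<close> whenever it is close enough to \<open>S\<close> at \<open>X\<close>. Iterating, \<open>v\<close> grows by about
  \<open>S\<close> at every step of \<open>X, X + H, X + 2 H, \<dots>\<close>, contradicting boundedness. So \<open>v\<close> is constant for every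
  mollification scale, hence \<open>u\<close> is constant.\<close>

subsection \<open>Gaussian averages\<close>

text \<open>Up to a constant, the operator is the subordination integral of
  \<open>(1 - P_r) u\<close> against \<open>r powr (- 1 - s)\<close>, where \<open>P_r\<close> is
  the heat semigroup in space combined with a shift by \<open>r\<close> into the past; hence only
  past-pointing \<open>H\<close> can be reached. The supremum of \<open>d\<close> need not be
  attained, and translates of \<open>u\<close> have no common modulus of continuity, since its
  Hoelder constants may grow at infinity. The maximum principle is therefore quantitative and needs
  two bounds uniform in the centre: a Lipschitz constant, so that a value of \<open>d\<close> well
  below \<open>S\<close> persists on a set of positive measure, and a bound
  \<open>C * r powr \<beta>\<close> with \<beta> > s on the heat defect, because the loss allowed by
  near-maximality is constant in \<open>r\<close> and not integrable against
  \<open>r powr (- 1 - s)\<close> at 0. Mollification gives both from boundedness alone, by moving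
  differences onto the kernel. The argument bounds increments from above only; applied to
  \<open>v\<close> and to \<open>- v\<close> it gives equality along every past vector, and any two
  points have a common past point.\<close>

definition gauss :: "'a::euclidean_space \<Rightarrow> real" where
  "gauss w = exp (- (norm w)\<^sup>2 / 4)"

text \<open>Substituting \<open>y = x + sqrt r w\<close> and \<open>\<tau> = t - r\<close> turns the operator, up to a nonzero constant,
  into the integral of \<open>heat_defect U X r\<close> against \<open>r powr (- 1 - s)\<close> over \<open>r > 0\<close>.
  The Gaussian weight is left unnormalised.\<close>

definition heat_defect :: "('a::euclidean_space \<times> real \<Rightarrow> real) \<Rightarrow> 'a \<times> real \<Rightarrow> real \<Rightarrow> real" where
  "heat_defect U X r = (LINT w|lborel. (U X - U (X + (sqrt r *\<^sub>R w, - r))) * gauss w)"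

lemma gauss_pos [simp]: "gauss w > 0"
  by (simp add: gauss_def)

lemma gauss_nonneg [simp]: "gauss w \<ge> 0"
  by (simp add: gauss_def)

lemma gauss_uminus [simp]: "gauss (- w) = gauss w"
  by (simp add: gauss_def)

lemma measurable_gauss [measurable]: "gauss \<in> borel_measurable borel"
  unfolding gauss_def by measurable

lemma lborel_integral_affine:
  fixes f :: "'a::euclidean_space \<Rightarrow> real"
  assumes c: "c \<noteq> 0" and [measurable]: "f \<in> borel_measurable borel"
  shows "(\<integral>x. f x \<partial>lborel) = \<bar>c\<bar> ^ DIM('a) * (\<integral>x. f (t + c *\<^sub>R x) \<partial>lborel)"
  by (subst lborel_affine[OF c, of t])
     (simp add: integral_density integral_distr ennreal_power)

text \<open>The integrand is a product over \<open>Basis\<close> of one-dimensional Gaussians, so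
  Tonelli reduces the claim to the real line, where the factor is a multiple of a normal
  density.\<close>

lemma integrable_exp_norm_sq:
  fixes a :: real
  assumes "a > 0"
  shows "integrable lborel (\<lambda>w::'a::euclidean_space. exp (- a * (norm w)\<^sup>2))"
proof -
  have eq: "exp (- a * (norm w)\<^sup>2) = (\<Prod>b\<in>Basis. exp (- a * (w \<bullet> b)\<^sup>2))" for w :: 'a
    by (subst power2_norm_eq_inner, subst euclidean_inner)
       (simp add: exp_sum sum_distrib_left power2_eq_square)
  \<comment> \<open>Variance \<open>1 / (2 * a)\<close> produces the exponent
    \<open>- a * x\<^sup>2\<close> and the normalising factor \<open>sqrt (a / pi)\<close>.\<close>
  have "(\<lambda>x::real. exp (- a * x\<^sup>2)) = (\<lambda>x. sqrt (pi / a) * normal_density 0 (sqrt (1 / (2 * a))) x)"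
    using assms by (auto simp: normal_density_def real_sqrt_divide real_sqrt_mult fun_eq_iff field_simps)
  then have i1: "integrable lborel (\<lambda>x::real. exp (- a * x\<^sup>2))"
    using assms by simp
  show ?thesis
  proof (rule integrableI_nonneg)
    have "(\<integral>\<^sup>+ w. ennreal (exp (- a * (norm (w::'a))\<^sup>2)) \<partial>lborel)
        = (\<integral>\<^sup>+ w. (\<Prod>b\<in>Basis. ennreal (exp (- a * ((w::'a) \<bullet> b)\<^sup>2))) \<partial>lborel)"
      by (simp only: eq) (simp add: prod_ennreal)
    also have "\<dots> = (\<Prod>b\<in>(Basis::'a set). \<integral>\<^sup>+ x. ennreal (exp (- a * x\<^sup>2)) \<partial>lborel)"
      by (rule nn_integral_lborel_prod) auto
    also have "\<dots> < \<infinity>"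
      using i1 by (subst nn_integral_eq_integral) (auto simp: power_less_top_ennreal)
    finally show "(\<integral>\<^sup>+ w. ennreal (exp (- a * (norm (w::'a))\<^sup>2)) \<partial>lborel) < \<infinity>" .
  qed auto
qed

lemma integrable_gauss [simp]: "integrable lborel (gauss :: 'a::euclidean_space \<Rightarrow> real)"
  using integrable_exp_norm_sq[of "1/4", where 'a='a] by (simp add: gauss_def[abs_def])

text \<open>The weight is the one met in \<open>heat_defect_le_powr\<close>:
  \<open>1 + (norm w)\<^sup>2\<close> bounds \<open>norm w powr (2 * \<beta>)\<close>, and another 1
  comes from the time increment. Half of the Gaussian exponent absorbs it, by
  \<open>1 + x \<le> exp x\<close> at \<open>x = (norm w)\<^sup>2 / 8\<close>.\<close>

lemma integrable_gauss_moment: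
  "integrable lborel (\<lambda>w::'a::euclidean_space. (2 + (norm w)\<^sup>2) * gauss w)"
proof (rule Bochner_Integration.integrable_bound)
  show "integrable lborel (\<lambda>w::'a. 8 * exp (- (1/8) * (norm w)\<^sup>2))"
    by (intro integrable_mult_right integrable_exp_norm_sq) auto
  show "AE w::'a in lborel. norm ((2 + (norm w)\<^sup>2) * gauss w) \<le> norm (8 * exp (- (1/8) * (norm w)\<^sup>2))"
  proof (rule AE_I2)
    fix w :: 'a
    have "2 + (norm w)\<^sup>2 \<le> 8 * (1 + (norm w)\<^sup>2 / 8)" by simp
    also have "\<dots> \<le> 8 * exp ((norm w)\<^sup>2 / 8)"
      by (intro mult_left_mono exp_ge_add_one_self) auto
    finally have "(2 + (norm w)\<^sup>2) * gauss w \<le> 8 * exp ((norm w)\<^sup>2 / 8) * gauss w"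
      by (intro mult_right_mono) auto
    also have "\<dots> = 8 * exp (- (1/8) * (norm w)\<^sup>2)"
      by (simp add: gauss_def flip: exp_add)
    finally show "norm ((2 + (norm w)\<^sup>2) * gauss w) \<le> norm (8 * exp (- (1/8) * (norm w)\<^sup>2))"
      by simp
  qed
qed measurable

section \<open>Domination and Fubini\<close>

lemma integrable_bounded_mult:
  fixes f g :: "'b \<Rightarrow> real"
  assumes "integrable M g" "f \<in> borel_measurable M" "\<And>x. \<bar>f x\<bar> \<le> B"
  shows "integrable M (\<lambda>x. f x * g x)"
proof (rule Bochner_Integration.integrable_bound)
  show "integrable M (\<lambda>x. B * g x)" using assms by simp
  have "\<bar>f x * g x\<bar> \<le> \<bar>B * g x\<bar>" for x
    using assms(3)[of x] by (auto simp: abs_mult intro!: mult_right_mono)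
  then show "AE x in M. norm (f x * g x) \<le> norm (B * g x)" by simp
qed (use assms in measurable)

lemma abs_integral_le:
  fixes f g :: "'b \<Rightarrow> real"
  assumes "integrable M f" "integrable M g" "\<And>x. \<bar>f x\<bar> \<le> g x"
  shows "\<bar>integral\<^sup>L M f\<bar> \<le> integral\<^sup>L M g"
proof -
  have "\<bar>integral\<^sup>L M f\<bar> \<le> (LINT x|M. \<bar>f x\<bar>)" by (rule integral_abs_bound)
  also have "\<dots> \<le> integral\<^sup>L M g" using assms by (intro integral_mono) auto
  finally show ?thesis .
qed

lemma integrable_lborel_prod_mult:
  fixes f :: "'a::euclidean_space \<Rightarrow> real" and g :: "'b::euclidean_space \<Rightarrow> real"
  assumes [simp]: "integrable lborel f" "integrable lborel g"
  shows "integrable (lborel \<Otimes>\<^sub>M lborel) (\<lambda>(x, y). f x * g y)"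
proof -
  have [measurable]: "f \<in> borel_measurable borel" "g \<in> borel_measurable borel"
    using assms[THEN borel_measurable_integrable] by auto
  show ?thesis
    by (rule lborel_pair.Fubini_integrable) (auto simp: abs_mult)
qed

lemma Fubini_lborel_dominated:
  fixes h :: "'a::euclidean_space \<Rightarrow> 'b::euclidean_space \<Rightarrow> real"
  assumes "integrable lborel f" "integrable lborel g"
    and [measurable]: "case_prod h \<in> borel_measurable (lborel \<Otimes>\<^sub>M lborel)"
    and bd: "\<And>x y. \<bar>h x y\<bar> \<le> f x * g y"
  shows "(\<integral>y. (\<integral>x. h x y \<partial>lborel) \<partial>lborel) = (\<integral>x. (\<integral>y. h x y \<partial>lborel) \<partial>lborel)"
proof (rule lborel_pair.Fubini_integral)
  show "integrable (lborel \<Otimes>\<^sub>M lborel) (case_prod h)"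
  proof (rule Bochner_Integration.integrable_bound[OF integrable_lborel_prod_mult[OF assms(1,2)]])
    have "\<bar>h x y\<bar> \<le> \<bar>f x * g y\<bar>" for x y using bd[of x y] by linarith
    then show "AE z in lborel \<Otimes>\<^sub>M lborel. norm (case z of (x, y) \<Rightarrow> h x y) \<le> norm (case z of (x, y) \<Rightarrow> f x * g y)"
      by (auto split: prod.split)
  qed measurable
qed

text \<open>Up to a constant, the Levy density of the s-stable subordinator. Extension by zero to
  \<open>r \<le> 0\<close> turns time integrals into integrals over the whole line, so that
  \<open>\<tau> = t - r\<close> is a plain affine substitution.\<close>

definition jump :: "real \<Rightarrow> real \<Rightarrow> real" where
  "jump s r = indicator {0<..} r * r powr (- 1 - s)"

lemma jump_nonneg [simp]: "jump s r \<ge> 0"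
  by (simp add: jump_def)

lemma measurable_jump [measurable]: "jump s \<in> borel_measurable borel"
  unfolding jump_def by measurable

text \<open>Up to 1 the integrand is at most \<open>C * r powr (\<beta> - s - 1)\<close>, integrable
  because \<open>s < \<beta>\<close>; beyond 1 it is at most \<open>A * r powr (- s - 1)\<close>,
  integrable because \<open>0 < s\<close>.\<close>

lemma integrable_jump_min:
  assumes "0 < s" "s < \<beta>" "0 \<le> A" "0 \<le> C"
  shows "integrable lborel (\<lambda>r. min A (C * r powr \<beta>) * jump s r)"
proof (rule Bochner_Integration.integrable_bound)
  have "(\<lambda>t. t powr (\<beta> - s - 1)) absolutely_integrable_on {0..1}"
    using integrable_on_powr_from_0[of "\<beta> - s - 1" 1] assms
    by (subst absolutely_integrable_on_iff_nonneg) auto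
  then have 1: "integrable lborel (\<lambda>r. indicator {0..1} r * r powr (\<beta> - s - 1))"
    unfolding set_integrable_def by (subst (asm) integrable_completion) auto
  have "(\<lambda>t. t powr (- s - 1)) absolutely_integrable_on {1..}"
    using has_integral_powr_to_inf[of "- s - 1" 1] assms
    by (subst absolutely_integrable_on_iff_nonneg) (auto simp: integrable_on_def)
  then have 2: "integrable lborel (\<lambda>r. indicator {1..} r * r powr (- s - 1))"
    unfolding set_integrable_def by (subst (asm) integrable_completion) auto
  show "integrable lborel (\<lambda>r. C * (indicator {0..1} r * r powr (\<beta> - s - 1)) + A * (indicator {1..} r * r powr (- s - 1)))"
    using 1 2 by simp
  show "AE r in lborel. norm (min A (C * r powr \<beta>) * jump s r)
      \<le> norm (C * (indicator {0..1} r * r powr (\<beta> - s - 1)) + A * (indicator {1..} r * r powr (- s - 1)))"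
  proof (rule AE_I2)
    fix r :: real
    have nn: "0 \<le> min A (C * r powr \<beta>)" using assms by simp
    consider "r \<le> 0" | "0 < r" "r \<le> 1" | "r > 1" by linarith
    then show "norm (min A (C * r powr \<beta>) * jump s r)
      \<le> norm (C * (indicator {0..1} r * r powr (\<beta> - s - 1)) + A * (indicator {1..} r * r powr (- s - 1)))"
    proof cases
      case 1 then show ?thesis by (simp add: jump_def)
    next
      case 2
      have "min A (C * r powr \<beta>) * jump s r \<le> C * r powr \<beta> * jump s r"
        by (intro mult_right_mono) auto
      also have "\<dots> = C * (indicator {0..1} r * r powr (\<beta> - s - 1))"
        using 2 by (simp add: jump_def algebra_simps flip: powr_add)
      also have "\<dots> \<le> C * (indicator {0..1} r * r powr (\<beta> - s - 1)) + A * (indicator {1..} r * r powr (- s - 1))"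
        using assms by simp
      finally show ?thesis using nn assms by (simp add: abs_mult)
    next
      case 3
      have "min A (C * r powr \<beta>) * jump s r \<le> A * jump s r"
        by (intro mult_right_mono) auto
      also have "\<dots> = A * (indicator {1..} r * r powr (- s - 1))"
        using 3 by (simp add: jump_def minus_diff_commute[of 1 s])
      also have "\<dots> \<le> C * (indicator {0..1} r * r powr (\<beta> - s - 1)) + A * (indicator {1..} r * r powr (- s - 1))"
        using assms by simp
      finally show ?thesis using nn assms by (simp add: abs_mult)
    qed
  qed
qed measurable

section \<open>Measurability and size of the heat defect\<close>

lemma measurable_heat_defect [measurable (raw)]:
  fixes U :: "'a::euclidean_space \<times> real \<Rightarrow> real"
  assumes U: "U \<in> borel_measurable borel"
    and f: "f \<in> borel_measurable M" and g: "g \<in> borel_measurable M"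
  shows "(\<lambda>z. heat_defect U (f z) (g z)) \<in> borel_measurable M"
proof -
  note U [measurable]
  have "(\<lambda>p. heat_defect U (fst p) (snd p)) \<in> borel_measurable (borel \<Otimes>\<^sub>M borel)"
    unfolding heat_defect_def by measurable
  from measurable_compose[OF measurable_Pair[OF f g] this] show ?thesis by simp
qed

lemma integrable_heat_defect:
  fixes U :: "'a::euclidean_space \<times> real \<Rightarrow> real"
  assumes [measurable]: "U \<in> borel_measurable borel" and M: "\<And>X. \<bar>U X\<bar> \<le> M"
  shows "integrable lborel (\<lambda>w. (U X - U (X + (sqrt r *\<^sub>R w, - r))) * gauss w)"
proof (rule integrable_bounded_mult[where B = "2 * M"])
  show "\<bar>U X - U (X + (sqrt r *\<^sub>R w, - r))\<bar> \<le> 2 * M" for w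
    using M[of X] M[of "X + (sqrt r *\<^sub>R w, - r)"] by linarith
qed auto

lemma heat_defect_bounded:
  fixes U :: "'a::euclidean_space \<times> real \<Rightarrow> real"
  assumes [measurable]: "U \<in> borel_measurable borel" and M: "\<And>X. \<bar>U X\<bar> \<le> M"
  shows "\<bar>heat_defect U X r\<bar> \<le> 2 * M * (LINT w|lborel. gauss (w::'a))"
proof -
  have "\<bar>heat_defect U X r\<bar> \<le> (LINT w|lborel. 2 * M * gauss (w::'a))"
    unfolding heat_defect_def
  proof (rule abs_integral_le)
    fix w :: 'a
    show "\<bar>(U X - U (X + (sqrt r *\<^sub>R w, - r))) * gauss w\<bar> \<le> 2 * M * gauss w"
      using M[of X] M[of "X + (sqrt r *\<^sub>R w, - r)"]
      by (auto simp: abs_mult intro!: mult_right_mono)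
  qed (use integrable_heat_defect[OF assms] in auto)
  then show ?thesis by simp
qed

text \<open>The Gaussian weight is even, so the first order term in space cancels.\<close>

lemma heat_defect_symmetrised:
  fixes U :: "'a::euclidean_space \<times> real \<Rightarrow> real"
  assumes [measurable]: "U \<in> borel_measurable borel" and M: "\<And>X. \<bar>U X\<bar> \<le> M"
  shows "2 * heat_defect U (x, t) r = (LINT w|lborel.
    (2 * U (x, t) - U (x + sqrt r *\<^sub>R w, t - r) - U (x - sqrt r *\<^sub>R w, t - r)) * gauss w)"
proof -
  have 1: "heat_defect U (x, t) r = (LINT w|lborel. (U (x, t) - U (x + sqrt r *\<^sub>R w, t - r)) * gauss w)"
    by (simp add: heat_defect_def)
  also have "\<dots> = (LINT w|lborel. (U (x, t) - U (x - sqrt r *\<^sub>R w, t - r)) * gauss w)"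
    by (subst lborel_integral_affine[where c = "-1" and t = 0]) auto
  finally have 2: "heat_defect U (x, t) r = (LINT w|lborel. (U (x, t) - U (x - sqrt r *\<^sub>R w, t - r)) * gauss w)" .
  have i1: "integrable lborel (\<lambda>w. (U (x, t) - U (x + sqrt r *\<^sub>R w, t - r)) * gauss w)"
    using integrable_heat_defect[OF assms, of "(x, t)" r] by simp
  have i2: "integrable lborel (\<lambda>w. (U (x, t) - U (x - sqrt r *\<^sub>R w, t - r)) * gauss w)"
  proof (rule integrable_bounded_mult[where B = "2 * M"])
    show "\<bar>U (x, t) - U (x - sqrt r *\<^sub>R w, t - r)\<bar> \<le> 2 * M" for w
      using M[of "(x, t)"] M[of "(x - sqrt r *\<^sub>R w, t - r)"] by linarith
  qed auto
  have "2 * heat_defect U (x, t) r = heat_defect U (x, t) r + heat_defect U (x, t) r" by simp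
  also have "\<dots> = (LINT w|lborel. (U (x, t) - U (x + sqrt r *\<^sub>R w, t - r)) * gauss w
                     + (U (x, t) - U (x - sqrt r *\<^sub>R w, t - r)) * gauss w)"
    using i1 i2 by (subst 1, subst 2) simp
  also have "\<dots> = (LINT w|lborel.
    (2 * U (x, t) - U (x + sqrt r *\<^sub>R w, t - r) - U (x - sqrt r *\<^sub>R w, t - r)) * gauss w)"
    by (rule Bochner_Integration.integral_cong) (auto simp: algebra_simps)
  finally show ?thesis .
qed

text \<open>Under the parabolic scaling \<open>h = sqrt r w\<close> the spatial term becomes
  \<open>r powr \<beta>\<close> times \<open>norm w powr (2 * \<beta>)\<close>, and
  \<open>\<beta> \<le> 1\<close> bounds the latter by a Gaussian moment. Second differences allow
  exponents \<open>2 * \<beta>\<close> up to 2 without any first order term.\<close>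

lemma heat_defect_le_powr:
  fixes U :: "'a::euclidean_space \<times> real \<Rightarrow> real"
  assumes [measurable]: "U \<in> borel_measurable borel" and M: "\<And>X. \<bar>U X\<bar> \<le> M"
    and \<beta>: "0 < \<beta>" "\<beta> \<le> 1" and C: "0 \<le> C" and r: "0 < r"
    and bd: "\<And>h. \<bar>U (x + h, t - r) + U (x - h, t - r) - 2 * U (x, t)\<bar>
                  \<le> C * (norm h powr (2 * \<beta>) + r powr \<beta>)"
  shows "\<bar>heat_defect U (x, t) r\<bar> \<le> C * (LINT w|lborel. (2 + (norm w)\<^sup>2) * gauss (w::'a)) * r powr \<beta>"
proof -
  have "\<bar>2 * heat_defect U (x, t) r\<bar> \<le> (LINT w|lborel. C * r powr \<beta> * ((2 + (norm w)\<^sup>2) * gauss (w::'a)))"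
    unfolding heat_defect_symmetrised[OF assms(1,2)]
  proof (rule abs_integral_le)
    show "integrable lborel (\<lambda>w. C * r powr \<beta> * ((2 + (norm w)\<^sup>2) * gauss (w::'a)))"
      by (intro integrable_mult_right integrable_gauss_moment)
    show "integrable lborel (\<lambda>w. (2 * U (x, t) - U (x + sqrt r *\<^sub>R w, t - r) - U (x - sqrt r *\<^sub>R w, t - r)) * gauss w)"
    proof (rule integrable_bounded_mult[where B = "4 * M"])
      show "\<bar>2 * U (x, t) - U (x + sqrt r *\<^sub>R w, t - r) - U (x - sqrt r *\<^sub>R w, t - r)\<bar> \<le> 4 * M" for w
        using M[of "(x, t)"] M[of "(x - sqrt r *\<^sub>R w, t - r)"] M[of "(x + sqrt r *\<^sub>R w, t - r)"] by linarith
    qed auto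
    fix w :: 'a
    have "norm (sqrt r *\<^sub>R w) powr (2 * \<beta>) = (r * (norm w)\<^sup>2) powr \<beta>"
      using r by (simp add: powr_powr[symmetric] power_mult_distrib)
    also have "\<dots> = r powr \<beta> * ((norm w)\<^sup>2) powr \<beta>"
      using r by (simp add: powr_mult)
    finally have e: "norm (sqrt r *\<^sub>R w) powr (2 * \<beta>) = r powr \<beta> * ((norm w)\<^sup>2) powr \<beta>" .
    have "((norm w)\<^sup>2) powr \<beta> \<le> 1 + (norm w)\<^sup>2"
    proof (cases "(norm w)\<^sup>2 \<le> 1")
      case True
      then have "((norm w)\<^sup>2) powr \<beta> \<le> 1" using \<beta> by (intro powr_le1) auto
      then show ?thesis using zero_le_power2[of "norm w"] by linarith
    next
      case False
      then have "((norm w)\<^sup>2) powr \<beta> \<le> ((norm w)\<^sup>2) powr 1" using \<beta> by (intro powr_mono) auto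
      then show ?thesis by simp
    qed
    then have "r powr \<beta> * ((norm w)\<^sup>2) powr \<beta> \<le> r powr \<beta> * (1 + (norm w)\<^sup>2)"
      by (intro mult_left_mono) auto
    then have *: "norm (sqrt r *\<^sub>R w) powr (2 * \<beta>) + r powr \<beta> \<le> r powr \<beta> * (2 + (norm w)\<^sup>2)"
      unfolding e by (simp add: algebra_simps)
    have "\<bar>2 * U (x, t) - U (x + sqrt r *\<^sub>R w, t - r) - U (x - sqrt r *\<^sub>R w, t - r)\<bar>
        \<le> C * (norm (sqrt r *\<^sub>R w) powr (2 * \<beta>) + r powr \<beta>)"
      using bd[of "sqrt r *\<^sub>R w"] by linarith
    also have "\<dots> \<le> C * (r powr \<beta> * (2 + (norm w)\<^sup>2))"
      using * C by (rule mult_left_mono)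
    finally show "\<bar>(2 * U (x, t) - U (x + sqrt r *\<^sub>R w, t - r) - U (x - sqrt r *\<^sub>R w, t - r)) * gauss w\<bar>
        \<le> C * r powr \<beta> * ((2 + (norm w)\<^sup>2) * gauss w)"
      by (simp add: abs_mult mult.assoc[symmetric] mult_right_mono)
  qed
  then have "2 * \<bar>heat_defect U (x, t) r\<bar> \<le> C * (LINT w|lborel. (2 + (norm w)\<^sup>2) * gauss (w::'a)) * r powr \<beta>"
    unfolding integral_mult_right_zero by (simp add: abs_mult mult.assoc mult.commute[of _ "r powr \<beta>"])
  then show ?thesis by linarith
qed

text \<open>For fixed \<open>r > 0\<close> there is no spatial singularity: a bounded function
  against a Gaussian is absolutely integrable, so by dominated convergence the principal value is
  the full integral. The Jacobian of \<open>y = x + sqrt r w\<close> cancels the factor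
  \<open>r powr (n / 2)\<close> of the kernel, \<open>n\<close> being the dimension.\<close>

lemma heat_defect_principal_value:
  fixes u :: "'a::euclidean_space \<Rightarrow> real \<Rightarrow> real"
  assumes [measurable]: "case_prod u \<in> borel_measurable borel" and M: "\<And>x t. \<bar>u x t\<bar> \<le> M"
    and r: "0 < r"
  shows "Lim (at_right (0::real))
          (\<lambda>\<delta>. LINT y:{y. \<delta> < dist y x}|lborel.
              (u x t - u y (t - r)) / r powr (real DIM('a) / 2 + 1 + s)
                * exp (- (norm (x - y))\<^sup>2 / (4 * r)))
       = r powr (- 1 - s) * heat_defect (case_prod u) (x, t) r"
proof -
  let ?U = "case_prod u" and ?n = "real DIM('a)"
  define G where "G w = (?U (x, t) - ?U ((x, t) + (sqrt r *\<^sub>R w, - r))) * gauss w" for w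
  have [measurable]: "G \<in> borel_measurable borel" unfolding G_def by measurable
  have iG: "integrable lborel G"
    unfolding G_def using M by (intro integrable_heat_defect) auto
  have um: "(\<lambda>y. u y (t - r)) \<in> borel_measurable borel"
    using measurable_compose[of "\<lambda>y. (y, t - r)" borel borel "case_prod u"] by simp
  note um [measurable]
  have eq: "(LINT y:{y. \<delta> < dist y x}|lborel.
              (u x t - u y (t - r)) / r powr (?n / 2 + 1 + s) * exp (- (norm (x - y))\<^sup>2 / (4 * r)))
        = r powr (- 1 - s) * (LINT w|lborel. indicator {w. \<delta> < sqrt r * norm w} w * G w)" for \<delta>
  proof -
    have e1: "- (norm (x - (x + sqrt r *\<^sub>R w)))\<^sup>2 / (4 * r) = - (norm w)\<^sup>2 / 4" for w :: 'a
      using r by (simp add: power_mult_distrib)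
    have e2: "\<bar>sqrt r\<bar> ^ DIM('a) / r powr (?n / 2 + 1 + s) = r powr (- 1 - s)"
    proof -
      have "\<bar>sqrt r\<bar> ^ DIM('a) = r powr (?n / 2)"
        using r by (simp add: powr_half_sqrt[symmetric] powr_powr flip: powr_realpow)
      then show ?thesis
        using r by (simp add: powr_diff[symmetric])
    qed
    have "(LINT y:{y. \<delta> < dist y x}|lborel.
              (u x t - u y (t - r)) / r powr (?n / 2 + 1 + s) * exp (- (norm (x - y))\<^sup>2 / (4 * r)))
       = \<bar>sqrt r\<bar> ^ DIM('a) * (LINT w|lborel. indicator {y. \<delta> < dist y x} (x + sqrt r *\<^sub>R w) *
              ((u x t - u (x + sqrt r *\<^sub>R w) (t - r)) / r powr (?n / 2 + 1 + s)
                * exp (- (norm (x - (x + sqrt r *\<^sub>R w)))\<^sup>2 / (4 * r))))"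
      unfolding set_lebesgue_integral_def real_scaleR_def
      using r by (subst lborel_integral_affine[where c = "sqrt r" and t = x]) auto
    also have "(\<lambda>w. indicator {y. \<delta> < dist y x} (x + sqrt r *\<^sub>R w) *
              ((u x t - u (x + sqrt r *\<^sub>R w) (t - r)) / r powr (?n / 2 + 1 + s)
                * exp (- (norm (x - (x + sqrt r *\<^sub>R w)))\<^sup>2 / (4 * r))))
        = (\<lambda>w. (indicator {w. \<delta> < sqrt r * norm w} w * G w) / r powr (?n / 2 + 1 + s))"
      unfolding e1 using r by (auto simp: indicator_def dist_norm G_def gauss_def)
    also have "\<bar>sqrt r\<bar> ^ DIM('a) * (LINT w|lborel. (indicator {w. \<delta> < sqrt r * norm w} w * G w) / r powr (?n / 2 + 1 + s))
        = (\<bar>sqrt r\<bar> ^ DIM('a) / r powr (?n / 2 + 1 + s)) * (LINT w|lborel. indicator {w. \<delta> < sqrt r * norm w} w * G w)"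
      by simp
    finally show ?thesis unfolding e2 .
  qed
  have "((\<lambda>\<delta>. LINT w|lborel. indicator {w. \<delta> < sqrt r * norm w} w * G w) \<longlongrightarrow> (LINT w|lborel. G w)) (at_right 0)"
  proof (rule tendsto_at_right_sequentially[of 0 1])
    fix S :: "nat \<Rightarrow> real" assume S: "S \<longlonglongrightarrow> 0"
    show "(\<lambda>n. LINT w|lborel. indicator {w. S n < sqrt r * norm w} w * G w) \<longlonglongrightarrow> (LINT w|lborel. G w)"
    proof (rule integral_dominated_convergence[where w = "\<lambda>w. \<bar>G w\<bar>"])
      show "AE w in lborel. (\<lambda>n. indicator {w. S n < sqrt r * norm w} w * G w) \<longlonglongrightarrow> G w"
      \<comment> \<open>The origin may stay inside every excised ball, but it is a null set.\<close>
      proof (rule AE_mp[OF AE_lborel_singleton[of 0]], rule AE_I2, rule impI)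
        fix w :: 'a assume "w \<noteq> 0"
        then have "eventually (\<lambda>n. S n < sqrt r * norm w) sequentially"
          using order_tendstoD(2)[OF S, of "sqrt r * norm w"] r by simp
        then have "eventually (\<lambda>n. indicator {w. S n < sqrt r * norm w} w * G w = G w) sequentially"
          by eventually_elim simp
        then show "(\<lambda>n. indicator {w. S n < sqrt r * norm w} w * G w) \<longlonglongrightarrow> G w"
          by (rule tendsto_eventually)
      qed
      show "AE w in lborel. norm (indicator {w. S n < sqrt r * norm w} w * G w) \<le> \<bar>G w\<bar>" for n
        by (auto simp: indicator_def)
    qed (use iG in auto)
  qed simp
  then have "((\<lambda>\<delta>. r powr (- 1 - s) * (LINT w|lborel. indicator {w. \<delta> < sqrt r * norm w} w * G w))
      \<longlongrightarrow> r powr (- 1 - s) * (LINT w|lborel. G w)) (at_right 0)"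
    by (rule tendsto_mult_left)
  then show ?thesis
    unfolding eq by (subst tendsto_Lim) (auto simp: heat_defect_def G_def)
qed

text \<open>After the reflection \<open>\<tau> = t - r\<close> the integrands agree pointwise: for
  \<open>\<tau> < t\<close> by the principal value computation, otherwise because both vanish.
  Convergence does not enter, since equal functions have equal Bochner integrals even at the default
  value.\<close>

lemma frac_heat_eq_jump_integral:
  fixes u :: "'a::euclidean_space \<Rightarrow> real \<Rightarrow> real"
  assumes "case_prod u \<in> borel_measurable borel" and M: "\<And>x t. \<bar>u x t\<bar> \<le> M"
  shows "frac_heat s u x t = frac_heat_const (real DIM('a)) s *
           (LINT r|lborel. jump s r * heat_defect (case_prod u) (x, t) r)"
proof -
  have "(LINT r|lborel. jump s r * heat_defect (case_prod u) (x, t) r)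
      = (LINT \<tau>|lborel. jump s (t - \<tau>) * heat_defect (case_prod u) (x, t) (t - \<tau>))"
    by (subst lborel_integral_real_affine[where c = "-1" and t = t]) auto
  also have "\<dots> = (LINT \<tau>:{..<t}|lborel.
        Lim (at_right (0::real))
          (\<lambda>\<delta>. LINT y:{y. \<delta> < dist y x}|lborel.
              (u x t - u y \<tau>) / (t - \<tau>) powr (real DIM('a) / 2 + 1 + s)
                * exp (- (norm (x - y))\<^sup>2 / (4 * (t - \<tau>)))))"
    unfolding set_lebesgue_integral_def
  proof (intro Bochner_Integration.integral_cong refl)
    fix \<tau>
    show "jump s (t - \<tau>) * heat_defect (case_prod u) (x, t) (t - \<tau>) =
      indicat_real {..<t} \<tau> *\<^sub>R Lim (at_right (0::real))
          (\<lambda>\<delta>. LINT y|lborel. indicat_real {y. \<delta> < dist y x} y *\<^sub>R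
              ((u x t - u y \<tau>) / (t - \<tau>) powr (real DIM('a) / 2 + 1 + s)
                * exp (- (norm (x - y))\<^sup>2 / (4 * (t - \<tau>)))))"
      using heat_defect_principal_value[OF assms, of "t - \<tau>" x t s]
      by (cases "\<tau> < t") (simp_all add: jump_def set_lebesgue_integral_def)
  qed
  finally show ?thesis by (simp add: frac_heat_def)
qed

text \<open>\<open>Gamma\<close> has the value 0 at its poles, where \<open>1 / 0 = 0\<close> would
  make the operator vanish identically; \<open>- s\<close> lies strictly between the poles -1 and
  0.\<close>

lemma frac_heat_const_nonzero:
  assumes "0 < s" "s < 1"
  shows "frac_heat_const n s \<noteq> 0"
proof -
  have "- s \<notin> \<int>\<^sub>\<le>\<^sub>0"
  proof
    assume "- s \<in> \<int>\<^sub>\<le>\<^sub>0"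
    then obtain n where "- s = real_of_int n" by (auto elim!: nonpos_Ints_cases)
    with assms have "- 1 < real_of_int n" "real_of_int n < 0" by linarith+
    then have "- 1 < n" "n < 0" by simp_all
    then show False by linarith
  qed
  then show ?thesis
    by (simp add: frac_heat_const_def Gamma_eq_zero_iff)
qed

subsection \<open>Liouville theorem for Lipschitz solutions\<close>

text \<open>A vanishing integral would force \<open>f = 0\<close> almost everywhere and hence make
  the nonempty open set \<open>A\<close> null.\<close>

lemma integral_pos_on_open:
  fixes f :: "'a::euclidean_space \<Rightarrow> real"
  assumes f: "integrable lborel f" and nn: "\<And>x. 0 \<le> f x"
    and A: "open A" "A \<noteq> {}" and pos: "\<And>x. x \<in> A \<Longrightarrow> 0 < f x"
  shows "0 < integral\<^sup>L lborel f"
proof (rule ccontr)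
  assume "\<not> 0 < integral\<^sup>L lborel f"
  moreover have "0 \<le> integral\<^sup>L lborel f" using nn by simp
  ultimately have "integral\<^sup>L lborel f = 0" by linarith
  then have "AE x in lborel. f x = 0"
    using f nn by (subst (asm) integral_nonneg_eq_0_iff_AE) auto
  then have "AE x in lborel. x \<notin> A"
    by eventually_elim (use pos in force)
  then have "A \<in> null_sets lborel"
    using A by (subst (asm) AE_iff_null_sets[symmetric]) auto
  then have "negligible A"
    by (simp add: negligible_iff_null_sets null_sets_completionI)
  with open_not_negligible[OF A] show False by simp
qed

text \<open>The power bound controls small \<open>r\<close>, boundedness of \<open>U\<close>
  controls large \<open>r\<close>, and the minimum of the two is the dominating function.\<close>

lemma integrable_jump_heat_defect:
  fixes U :: "'a::euclidean_space \<times> real \<Rightarrow> real"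
  assumes "0 < s" "s < \<beta>" and U [measurable]: "U \<in> borel_measurable borel" and M: "\<And>X. \<bar>U X\<bar> \<le> M"
    and C: "0 \<le> C" and bd: "\<And>r. 0 < r \<Longrightarrow> \<bar>heat_defect U X r\<bar> \<le> C * r powr \<beta>"
  shows "integrable lborel (\<lambda>r. jump s r * heat_defect U X r)"
proof -
  define A where "A = 2 * M * (LINT w|lborel. gauss (w::'a))"
  have A: "\<bar>heat_defect U X r\<bar> \<le> A" for r
    unfolding A_def by (rule heat_defect_bounded[OF U M])
  have "0 \<le> A" using A[of 0] by linarith
  show ?thesis
  proof (rule Bochner_Integration.integrable_bound)
    show "integrable lborel (\<lambda>r. min A (C * r powr \<beta>) * jump s r)"
      using assms \<open>0 \<le> A\<close> by (intro integrable_jump_min)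
    have "\<bar>jump s r * heat_defect U X r\<bar> \<le> \<bar>min A (C * r powr \<beta>) * jump s r\<bar>" for r
    proof (cases "r > 0")
      case True
      then have "\<bar>heat_defect U X r\<bar> \<le> min A (C * r powr \<beta>)" using A bd by simp
      then have "jump s r * \<bar>heat_defect U X r\<bar> \<le> jump s r * min A (C * r powr \<beta>)"
        by (rule mult_left_mono) simp
      moreover have "0 \<le> min A (C * r powr \<beta>)" using \<open>0 \<le> A\<close> C by simp
      ultimately show ?thesis by (simp add: abs_mult mult.commute)
    qed (simp add: jump_def)
    then show "AE r in lborel. norm (jump s r * heat_defect U X r) \<le> norm (min A (C * r powr \<beta>) * jump s r)"
      by simp
  qed measurable
qed

text \<open>A quantitative strong maximum principle, in which \<epsilon>' does not depend on
  \<open>X\<close>. If \<open>d (X + (h, - \<tau>)) \<le> S - \<epsilon>\<close>, the values near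
  that point contribute a fixed positive amount to the jump integral at \<open>X\<close>, while
  elsewhere the increments are above \<open>- \<epsilon>'\<close>; for small \<epsilon>' the
  integral cannot vanish.\<close>

lemma near_sup_propagates:
  fixes d :: "'a::euclidean_space \<times> real \<Rightarrow> real"
  assumes s: "0 < s" "s < \<beta>" and M: "\<And>X. \<bar>d X\<bar> \<le> M"
    and L: "0 < L" "\<And>X Y. \<bar>d X - d Y\<bar> \<le> L * dist X Y"
    and C: "0 \<le> C" "\<And>X r. 0 < r \<Longrightarrow> \<bar>heat_defect d X r\<bar> \<le> C * r powr \<beta>"
    and eq: "\<And>X. (LINT r|lborel. jump s r * heat_defect d X r) = 0"
    and S: "\<And>X. d X \<le> S" and \<tau>: "0 < \<tau>" and \<epsilon>: "0 < \<epsilon>"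
  shows "\<exists>\<epsilon>'>0. \<forall>X. d X > S - \<epsilon>' \<longrightarrow> d (X + (h, - \<tau>)) > S - \<epsilon>"
proof -
  have "L-lipschitz_on UNIV d"
    using L by (intro lipschitz_onI) (auto simp: dist_real_def)
  then have "continuous_on UNIV d" by (rule lipschitz_on_continuous_on)
  then have dm [measurable]: "d \<in> borel_measurable borel" by (rule borel_measurable_continuous_onI)
  define E where "E = (LINT w|lborel. gauss (w::'a))"
  have E: "0 \<le> E" unfolding E_def by simp
  \<comment> \<open>\<open>L * \<rho> = \<epsilon> / 2\<close>, so half of the gap below
    \<open>S\<close> survives within distance \<rho>.\<close>
  define \<rho> where "\<rho> = \<epsilon> / (2 * L)"
  have \<rho>: "0 < \<rho>" using L \<epsilon> by (simp add: \<rho>_def)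
  \<comment> \<open>In the coordinates \<open>(w, r)\<close> of \<open>heat_defect\<close> the
    displacement \<open>(h, - \<tau>)\<close> is attained at \<open>(w0, \<tau>)\<close>, and by
    continuity approximately attained nearby.\<close>
  define w0 where "w0 = h /\<^sub>R sqrt \<tau>"
  have "continuous (at (w0, \<tau>)) (\<lambda>p. (sqrt (snd p) *\<^sub>R fst p, - snd p))"
    by (intro continuous_intros)
  then obtain \<eta> where \<eta>: "0 < \<eta>"
    and cl: "\<And>p. dist p (w0, \<tau>) < \<eta> \<Longrightarrow> dist (sqrt (snd p) *\<^sub>R fst p, - snd p) (h, - \<tau>) < \<rho>"
    using \<rho> \<tau> unfolding continuous_at_eps_delta by (force simp: w0_def)
  define W where "W = ball w0 (\<eta> / 2)"
  \<comment> \<open>The interval lies to the right of \<tau>, hence away from the singularity of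
    \<open>jump s\<close> at 0.\<close>
  define I where "I = {\<tau> <..< \<tau> + \<eta> / 2}"
  have WI: "dist (sqrt r *\<^sub>R w, - r) (h, - \<tau>) < \<rho>" if "w \<in> W" "r \<in> I" for w r
  proof -
    have "dist (w, r) (w0, \<tau>) \<le> dist w w0 + dist r \<tau>"
      unfolding dist_Pair_Pair using sqrt_sum_squares_le_sum[of "dist w w0" "dist r \<tau>"] by simp
    also have "\<dots> < \<eta>" using that by (auto simp: W_def I_def dist_commute dist_real_def)
    finally show ?thesis using cl[of "(w, r)"] by simp
  qed
  have [measurable]: "W \<in> sets borel" "I \<in> sets borel" by (auto simp: W_def I_def)
  define \<gamma> where "\<gamma> = (LINT w|lborel. indicator W w * gauss (w::'a))"
  have iW: "integrable lborel (\<lambda>w. indicator W w * gauss (w::'a))"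
    by (rule integrable_bounded_mult[where B = 1]) (auto simp: indicator_def)
  have \<gamma>: "0 < \<gamma>"
    unfolding \<gamma>_def using iW \<eta> by (intro integral_pos_on_open[where A = W]) (auto simp: W_def)
  define J where "J = (LINT r|lborel. indicator I r * jump s r)"
  have iI: "integrable lborel (\<lambda>r. indicator I r * jump s r)"
  proof (rule Bochner_Integration.integrable_bound)
    \<comment> \<open>On \<open>I\<close> the factor \<open>min 1 (r powr \<beta>)\<close> is at
      least \<open>min 1 (\<tau> powr \<beta>)\<close>; dividing by the latter makes the integrable
      function dominate \<open>jump s\<close> there.\<close>
    show "integrable lborel (\<lambda>r. 1 / min 1 (\<tau> powr \<beta>) * (min 1 (1 * r powr \<beta>) * jump s r))"
      using s by (intro integrable_mult_right integrable_jump_min) auto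
    have "\<bar>indicator I r * jump s r\<bar> \<le> 1 / min 1 (\<tau> powr \<beta>) * (min 1 (1 * r powr \<beta>) * jump s r)" for r
    proof (cases "r \<in> I")
      case True
      then have "\<tau> powr \<beta> \<le> r powr \<beta>"
        using \<tau> s by (intro powr_mono2) (auto simp: I_def)
      then have "min 1 (\<tau> powr \<beta>) \<le> min 1 (r powr \<beta>)" by simp
      moreover have "0 < min 1 (\<tau> powr \<beta>)" using \<tau> by simp
      ultimately have "1 \<le> 1 / min 1 (\<tau> powr \<beta>) * min 1 (r powr \<beta>)"
        by (simp add: le_divide_eq)
      then have "1 * jump s r \<le> 1 / min 1 (\<tau> powr \<beta>) * min 1 (r powr \<beta>) * jump s r"
        by (rule mult_right_mono) simp
      then show ?thesis using True by simp
    qed simp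
    then show "AE r in lborel. norm (indicator I r * jump s r)
        \<le> norm (1 / min 1 (\<tau> powr \<beta>) * (min 1 (1 * r powr \<beta>) * jump s r))"
      by (intro AE_I2) (metis real_norm_def abs_ge_self order_trans)
  qed measurable
  have J: "0 < J"
    unfolding J_def using iI \<eta> \<tau> by (intro integral_pos_on_open[where A = I]) (auto simp: I_def jump_def)
  \<comment> \<open>A constant loss is not integrable against \<open>jump s\<close> at 0. Capping it
    by \<open>C * r powr \<beta>\<close>, the a priori bound on the heat defect, makes the total
    loss tend to 0 by dominated convergence.\<close>
  have lim: "(\<lambda>k. LINT r|lborel. min (E / Suc k) (C * r powr \<beta>) * jump s r) \<longlonglongrightarrow> (LINT r|(lborel::real measure). (0::real))"
  proof (rule integral_dominated_convergence[where w = "\<lambda>r. min E (C * r powr \<beta>) * jump s r"])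
    show "integrable lborel (\<lambda>r. min E (C * r powr \<beta>) * jump s r)"
      using s E C by (intro integrable_jump_min)
    have "(\<lambda>k. min (E / Suc k) (C * r powr \<beta>) * jump s r) \<longlonglongrightarrow> min 0 (C * r powr \<beta>) * jump s r" for r
      by (intro tendsto_mult tendsto_min tendsto_const LIMSEQ_Suc[OF lim_const_over_n])
    moreover have "min 0 (C * r powr \<beta>) = 0" for r using C by simp
    ultimately show "AE r in lborel. (\<lambda>k. min (E / Suc k) (C * r powr \<beta>) * jump s r) \<longlonglongrightarrow> 0" by simp
    have "E / Suc k \<le> E" for k
      using E by (simp add: divide_le_eq mult_le_cancel_left1)
    then have "min (E / Suc k) (C * r powr \<beta>) * jump s r \<le> min E (C * r powr \<beta>) * jump s r" for k r
      by (intro mult_right_mono min.mono) auto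
    moreover have "0 \<le> min (E / Suc k) (C * r powr \<beta>)" for k r using E C by simp
    ultimately show "AE r in lborel. norm (min (E / Suc k) (C * r powr \<beta>) * jump s r) \<le> min E (C * r powr \<beta>) * jump s r" for k
      by (simp add: abs_mult)
  qed measurable
  have "0 < \<gamma> * \<epsilon> / 4 * J" using \<gamma> \<epsilon> J by simp
  moreover have "(\<lambda>k. LINT r|lborel. min (E / Suc k) (C * r powr \<beta>) * jump s r) \<longlonglongrightarrow> 0"
    using lim by simp
  ultimately have ev1: "eventually (\<lambda>k. (LINT r|lborel. min (E / Suc k) (C * r powr \<beta>) * jump s r) < \<gamma> * \<epsilon> / 4 * J) sequentially"
    by (intro order_tendstoD(2))
  have "(\<lambda>k. E / Suc k) \<longlonglongrightarrow> 0" by (rule LIMSEQ_Suc[OF lim_const_over_n])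
  then have ev2: "eventually (\<lambda>k. E / Suc k < \<gamma> * \<epsilon> / 4) sequentially"
    using \<gamma> \<epsilon> by (intro order_tendstoD(2)) auto
  \<comment> \<open>\<open>k1\<close> keeps the total loss below the total gain; \<open>k2\<close>
    keeps the loss at each \<open>r\<close> in \<open>I\<close> below half of the gain
    \<open>\<gamma> * \<epsilon> / 2\<close>.\<close>
  from eventually_conj[OF ev1 ev2] obtain k
    where k1: "(LINT r|lborel. min (E / Suc k) (C * r powr \<beta>) * jump s r) < \<gamma> * \<epsilon> / 4 * J"
      and k2: "E / Suc k < \<gamma> * \<epsilon> / 4"
    by (auto simp: eventually_sequentially)
  define \<epsilon>' where "\<epsilon>' = 1 / real (Suc k)"
  have \<epsilon>': "0 < \<epsilon>'" by (simp add: \<epsilon>'_def)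
  have "d (X + (h, - \<tau>)) > S - \<epsilon>" if X: "d X > S - \<epsilon>'" for X
  proof (rule ccontr)
    assume "\<not> d (X + (h, - \<tau>)) > S - \<epsilon>"
    then have low: "d (X + (h, - \<tau>)) \<le> S - \<epsilon>" by simp
    have low': "d (X + Z) \<le> S - \<epsilon> / 2" if "dist Z (h, - \<tau>) < \<rho>" for Z
    proof -
      have "\<bar>d (X + Z) - d (X + (h, - \<tau>))\<bar> \<le> L * dist Z (h, - \<tau>)"
        using L(2)[of "X + Z" "X + (h, - \<tau>)"] by simp
      also have "\<dots> \<le> L * \<rho>" using that L by simp
      also have "\<dots> = \<epsilon> / 2" using L by (simp add: \<rho>_def)
      finally show ?thesis using low by linarith
    qed
    \<comment> \<open>The loss \<epsilon>' is allowed everywhere because \<open>d \<le> S\<close>;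
      the gain \<open>\<epsilon> / 2\<close> is available on \<open>W\<close> and \<open>I\<close>
      through \<open>low'\<close>.\<close>
    have hd1: "- \<epsilon>' * E + indicator I r * (\<epsilon> / 2) * \<gamma> \<le> heat_defect d X r" for r
    proof -
      have "- \<epsilon>' * E + indicator I r * (\<epsilon> / 2) * \<gamma>
          = (LINT w|lborel. - \<epsilon>' * gauss (w::'a) + indicator I r * (\<epsilon> / 2) * (indicator W w * gauss w))"
        using iW by (simp add: E_def \<gamma>_def)
      also have "\<dots> \<le> heat_defect d X r"
        unfolding heat_defect_def
      proof (rule integral_mono)
        fix w :: 'a
        have "- \<epsilon>' + indicator I r * (\<epsilon> / 2) * indicator W w \<le> d X - d (X + (sqrt r *\<^sub>R w, - r))"
          using X S[of "X + (sqrt r *\<^sub>R w, - r)"] low'[OF WI, of w r]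
          by (cases "w \<in> W \<and> r \<in> I") (auto simp: indicator_def)
        then have "(- \<epsilon>' + indicator I r * (\<epsilon> / 2) * indicator W w) * gauss w
            \<le> (d X - d (X + (sqrt r *\<^sub>R w, - r))) * gauss w"
          by (rule mult_right_mono) simp
        then show "- \<epsilon>' * gauss w + indicator I r * (\<epsilon> / 2) * (indicator W w * gauss w)
            \<le> (d X - d (X + (sqrt r *\<^sub>R w, - r))) * gauss w"
          by (simp add: algebra_simps)
      qed (use iW integrable_heat_defect[OF dm M] in auto)
      finally show ?thesis .
    qed
    have "(LINT r|lborel. \<gamma> * \<epsilon> / 4 * (indicator I r * jump s r) - min (E / Suc k) (C * r powr \<beta>) * jump s r)
        \<le> (LINT r|lborel. jump s r * heat_defect d X r)"
    proof (rule integral_mono)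
      show "integrable lborel (\<lambda>r. jump s r * heat_defect d X r)"
        by (rule integrable_jump_heat_defect[OF s dm M C])
      show "integrable lborel (\<lambda>r. \<gamma> * \<epsilon> / 4 * (indicator I r * jump s r) - min (E / Suc k) (C * r powr \<beta>) * jump s r)"
        using iI s E C by (intro Bochner_Integration.integrable_diff integrable_mult_right integrable_jump_min) auto
      fix r :: real
      show "\<gamma> * \<epsilon> / 4 * (indicator I r * jump s r) - min (E / Suc k) (C * r powr \<beta>) * jump s r
          \<le> jump s r * heat_defect d X r"
      proof (cases "r > 0")
        case True
        have nn: "0 \<le> min (E / Suc k) (C * r powr \<beta>)" using E C by simp
        \<comment> \<open>On \<open>I\<close> half of the gain pays for the loss; off
          \<open>I\<close> both \<open>- (E / Suc k)\<close> and \<open>- C * r powr \<beta>\<close>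
          are lower bounds, hence so is minus their minimum.\<close>
        have "\<gamma> * \<epsilon> / 4 * indicator I r - min (E / Suc k) (C * r powr \<beta>) \<le> heat_defect d X r"
        proof (cases "r \<in> I")
          case True
          then have "- (E / Suc k) + \<epsilon> / 2 * \<gamma> \<le> heat_defect d X r"
            using hd1[of r] by (simp add: \<epsilon>'_def)
          moreover have "\<gamma> * \<epsilon> / 4 * indicator I r = \<gamma> * \<epsilon> / 4" "\<epsilon> / 2 * \<gamma> = 2 * (\<gamma> * \<epsilon> / 4)"
            using True by simp_all
          ultimately show ?thesis using k2 nn by linarith
        next
          case False
          then show ?thesis using hd1[of r] C(2)[OF \<open>r > 0\<close>, of X] by (auto simp: \<epsilon>'_def min_def abs_le_iff)
        qed
        then have "jump s r * (\<gamma> * \<epsilon> / 4 * indicator I r - min (E / Suc k) (C * r powr \<beta>)) \<le> jump s r * heat_defect d X r"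
          by (rule mult_left_mono) simp
        then show ?thesis by (simp add: algebra_simps)
      qed (simp add: jump_def)
    qed
    also have "\<dots> = 0" by (rule eq)
    also have "(LINT r|lborel. \<gamma> * \<epsilon> / 4 * (indicator I r * jump s r) - min (E / Suc k) (C * r powr \<beta>) * jump s r)
        = \<gamma> * \<epsilon> / 4 * J - (LINT r|lborel. min (E / Suc k) (C * r powr \<beta>) * jump s r)"
      unfolding J_def using iI s E C
      by (subst Bochner_Integration.integral_diff) (auto intro!: integrable_jump_min)
    finally show False using k1 by linarith
  qed
  with \<epsilon>' show ?thesis by blast
qed

lemma heat_defect_diff_shift:
  fixes v :: "'a::euclidean_space \<times> real \<Rightarrow> real"
  assumes vm [measurable]: "v \<in> borel_measurable borel" and M: "\<And>X. \<bar>v X\<bar> \<le> M"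
  shows "heat_defect (\<lambda>X. v (X + H) - v X) X r = heat_defect v (X + H) r - heat_defect v X r"
proof -
  have "heat_defect (\<lambda>X. v (X + H) - v X) X r = (LINT w|lborel.
      (v (X + H) - v (X + H + (sqrt r *\<^sub>R w, - r))) * gauss w - (v X - v (X + (sqrt r *\<^sub>R w, - r))) * gauss w)"
    unfolding heat_defect_def
    by (intro Bochner_Integration.integral_cong) (auto simp: algebra_simps)
  also have "\<dots> = heat_defect v (X + H) r - heat_defect v X r"
    unfolding heat_defect_def
    by (intro Bochner_Integration.integral_diff integrable_heat_defect[OF vm M])
  finally show ?thesis .
qed

text \<open>The order of choices matters: the number of steps is fixed first, from \<open>M\<close>
  and \<open>S\<close>, and only then is a starting point taken where \<open>d\<close> is close
  enough to \<open>S\<close> for all of these steps.\<close>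

lemma increment_nonpos:
  fixes v :: "'a::euclidean_space \<times> real \<Rightarrow> real"
  assumes s: "0 < s" "s < \<beta>" and M: "\<And>X. \<bar>v X\<bar> \<le> M"
    and L: "0 < L" "\<And>X Y. \<bar>v X - v Y\<bar> \<le> L * dist X Y"
    and C: "0 \<le> C" "\<And>X r. 0 < r \<Longrightarrow> \<bar>heat_defect v X r\<bar> \<le> C * r powr \<beta>"
    and eq: "\<And>X. (LINT r|lborel. jump s r * heat_defect v X r) = 0"
    and \<tau>: "0 < \<tau>"
  shows "v (X0 + (h, - \<tau>)) \<le> v X0"
proof -
  have "L-lipschitz_on UNIV v"
    using L by (intro lipschitz_onI) (auto simp: dist_real_def)
  then have "continuous_on UNIV v" by (rule lipschitz_on_continuous_on)
  then have vm [measurable]: "v \<in> borel_measurable borel" by (rule borel_measurable_continuous_onI)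
  define H where "H = (h, - \<tau>)"
  define d where "d X = v (X + H) - v X" for X
  have dM: "\<bar>d X\<bar> \<le> 2 * M" for X
    using M[of X] M[of "X + H"] by (simp add: d_def)
  have bdd: "bdd_above (range d)"
    by (rule bdd_aboveI[of _ "2 * M"]) (use dM abs_le_D1 in auto)
  define S where "S = (SUP X. d X)"
  have S: "d X \<le> S" for X unfolding S_def using bdd by (intro cSUP_upper) auto
  have dL: "\<bar>d X - d Y\<bar> \<le> (2 * L) * dist X Y" for X Y
    using L(2)[of X Y] L(2)[of "X + H" "Y + H"] by (simp add: d_def)
  have hd: "heat_defect d X r = heat_defect v (X + H) r - heat_defect v X r" for X r
    unfolding d_def by (rule heat_defect_diff_shift[OF vm M])
  have dC: "\<bar>heat_defect d X r\<bar> \<le> (2 * C) * r powr \<beta>" if "0 < r" for X r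
    using C(2)[OF that, of X] C(2)[OF that, of "X + H"] unfolding hd by (simp add: algebra_simps)
  have deq: "(LINT r|lborel. jump s r * heat_defect d X r) = 0" for X
    unfolding hd right_diff_distrib
    using integrable_jump_heat_defect[OF s vm M C] by (simp add: eq)
  \<comment> \<open>The doubled constants reflect that \<open>d\<close> is a difference of two
    translates of \<open>v\<close>.\<close>
  have step: "\<exists>\<epsilon>'>0. \<forall>X. d X > S - \<epsilon>' \<longrightarrow> d (X + H) > S - \<epsilon>" if "0 < \<epsilon>" for \<epsilon>
    unfolding H_def using L(1) C(1)
    by (intro near_sup_propagates[of s \<beta> d "2 * M" "2 * L" "2 * C", OF s dM _ dL _ dC deq S \<tau> that]) auto
  have iter: "\<exists>\<epsilon>'>0. \<forall>X. d X > S - \<epsilon>' \<longrightarrow> v (X + real m *\<^sub>R H) - v X \<ge> real m * (S - \<epsilon>)" if "0 < \<epsilon>" for m \<epsilon>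
  proof (induction m)
    case 0
    then show ?case by (auto intro: exI[of _ 1])
  next
    case (Suc m)
    then obtain e1 where e1: "0 < e1" "\<And>X. d X > S - e1 \<Longrightarrow> v (X + real m *\<^sub>R H) - v X \<ge> real m * (S - \<epsilon>)"
      by blast
    obtain e2 where e2: "0 < e2" "\<And>X. d X > S - e2 \<Longrightarrow> d (X + H) > S - e1"
      using step[OF e1(1)] by auto
    \<comment> \<open>The threshold \<open>e2\<close> hands closeness \<open>e1\<close> on to
      \<open>X + H\<close>, from where the remaining \<open>m\<close> steps run; the threshold
      \<epsilon> gives the size of the first increment.\<close>
    have "v (X + real (Suc m) *\<^sub>R H) - v X \<ge> real (Suc m) * (S - \<epsilon>)" if "d X > S - min e2 \<epsilon>" for X
    proof -
      have "v (X + H + real m *\<^sub>R H) - v (X + H) \<ge> real m * (S - \<epsilon>)"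
        using that by (intro e1 e2) auto
      moreover have "v (X + H) - v X \<ge> S - \<epsilon>" using that by (simp add: d_def)
      moreover have "X + real (Suc m) *\<^sub>R H = X + H + real m *\<^sub>R H" by (simp add: algebra_simps)
      ultimately show ?thesis by (simp add: algebra_simps)
    qed
    then show ?case using e2(1) that by (intro exI[of _ "min e2 \<epsilon>"]) auto
  qed
  have "S \<le> 0"
  proof (rule ccontr)
    assume "\<not> S \<le> 0"
    then have Sp: "0 < S" by simp
    \<comment> \<open>Conceding half of \<open>S\<close> at each step, \<open>m\<close> steps still
      exceed \<open>2 * M\<close>, the largest possible oscillation of \<open>v\<close>.\<close>
    obtain m :: nat where m: "2 * M < real m * (S / 2)"
      using reals_Archimedean3[of "S / 2"] Sp by (metis half_gt_zero)
    obtain e where e: "0 < e" "\<And>X. d X > S - e \<Longrightarrow> v (X + real m *\<^sub>R H) - v X \<ge> real m * (S - S / 2)"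
      using iter[of "S / 2" m] Sp by auto
    obtain X where "d X > S - e"
      using less_cSUP_iff[OF _ bdd, of "S - e"] e(1) by (auto simp: S_def)
    from e(2)[OF this] m M[of X] M[of "X + real m *\<^sub>R H"] show False by simp
  qed
  with S[of X0] show ?thesis by (simp add: d_def H_def)
qed

lemma heat_defect_uminus: "heat_defect (\<lambda>X. - v X) X r = - heat_defect v X r"
  unfolding heat_defect_def
  by (subst integral_minus[symmetric]) (simp add: algebra_simps)

text \<open>The one-sided inequality for \<open>v\<close> and for \<open>- v\<close> identifies the
  value at a point with the value at every strictly earlier point; a common earlier point then links
  \<open>X\<close> and \<open>Y\<close>.\<close>

lemma liouville_lipschitz:
  fixes v :: "'a::euclidean_space \<times> real \<Rightarrow> real"
  assumes s: "0 < s" "s < \<beta>" and M: "\<And>X. \<bar>v X\<bar> \<le> M"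
    and L: "0 < L" "\<And>X Y. \<bar>v X - v Y\<bar> \<le> L * dist X Y"
    and C: "0 \<le> C" "\<And>X r. 0 < r \<Longrightarrow> \<bar>heat_defect v X r\<bar> \<le> C * r powr \<beta>"
    and eq: "\<And>X. (LINT r|lborel. jump s r * heat_defect v X r) = 0"
  shows "v X = v Y"
proof -
  have past: "v (X + (h, - \<tau>)) = v X" if "0 < \<tau>" for X h \<tau>
  proof (rule antisym)
    show "v (X + (h, - \<tau>)) \<le> v X"
      by (rule increment_nonpos[OF s M L C eq that])
    have "- v (X + (h, - \<tau>)) \<le> - v X"
      by (rule increment_nonpos[OF s _ L(1) _ C(1) _ _ that, where v = "\<lambda>X. - v X"])
         (use M L(2) C(2) eq in \<open>auto simp: heat_defect_uminus abs_minus_commute\<close>)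
    then show "v X \<le> v (X + (h, - \<tau>))" by simp
  qed
  \<comment> \<open>Subtracting 1 makes \<open>T\<close> strictly earlier than both times, as
    \<open>past\<close> requires.\<close>
  define T where "T = min (snd X) (snd Y) - 1"
  have "v Z = v (0, T)" if "snd Z > T" for Z
    using past[of "snd Z - T" Z "- fst Z"] that by (cases Z) simp
  from this[of X] this[of Y] show ?thesis by (simp add: T_def)
qed

subsection \<open>Mollification\<close>

text \<open>A kernel of class C^{1,1} suffices, since only second differences of order
  \<open>(norm H)\<^sup>2\<close> are used; the squared positive part keeps the estimates
  polynomial. The kernel is not normalised, which does not affect whether a mollification is
  constant.\<close>

definition bump :: "real \<Rightarrow> 'b::euclidean_space \<Rightarrow> real" where
  "bump \<delta> Z = (max 0 (\<delta>\<^sup>2 - (norm Z)\<^sup>2))\<^sup>2"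

definition mollify :: "real \<Rightarrow> ('b::euclidean_space \<Rightarrow> real) \<Rightarrow> 'b \<Rightarrow> real" where
  "mollify \<delta> U X = (LINT Z|lborel. bump \<delta> Z * U (X - Z))"

lemma bump_nonneg [simp]: "0 \<le> bump \<delta> Z"
  by (simp add: bump_def)

lemma measurable_bump [measurable]: "bump \<delta> \<in> borel_measurable borel"
  unfolding bump_def by measurable

lemma bump_eq_0: "0 \<le> \<delta> \<Longrightarrow> \<delta> \<le> norm Z \<Longrightarrow> bump \<delta> Z = 0"
  by (simp add: bump_def power_mono max_def)

lemma bump_pos: "norm Z < \<delta> \<Longrightarrow> 0 < bump \<delta> Z"
  using power_strict_mono[of "norm Z" \<delta> 2] by (simp add: bump_def)

lemma integrable_indicator_cball [simp]:
  "integrable lborel (indicator (cball c e) :: 'b::euclidean_space \<Rightarrow> real)"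
  using emeasure_lborel_cball_finite[of c e] by (intro integrable_real_indicator) auto

lemma integrable_bump [simp]:
  assumes "0 \<le> \<delta>"
  shows "integrable lborel (bump \<delta> :: 'b::euclidean_space \<Rightarrow> real)"
proof (rule Bochner_Integration.integrable_bound)
  show "integrable lborel (\<lambda>Z::'b. (\<delta>\<^sup>2)\<^sup>2 * indicator (cball 0 \<delta>) Z)" by simp
  have "\<bar>bump \<delta> Z\<bar> \<le> \<bar>(\<delta>\<^sup>2)\<^sup>2 * indicator (cball 0 \<delta>) Z\<bar>" for Z :: 'b
  proof (cases "norm Z \<le> \<delta>")
    case True
    have "(max 0 (\<delta>\<^sup>2 - (norm Z)\<^sup>2))\<^sup>2 \<le> (\<delta>\<^sup>2)\<^sup>2"
      by (intro power_mono) auto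
    with True show ?thesis by (simp add: bump_def)
  qed (use assms in \<open>simp add: bump_eq_0\<close>)
  then show "AE Z::'b in lborel. norm (bump \<delta> Z) \<le> norm ((\<delta>\<^sup>2)\<^sup>2 * indicator (cball 0 \<delta>) Z)"
    by simp
qed measurable

lemma integrable_bump_mult:
  fixes U :: "'b::euclidean_space \<Rightarrow> real"
  assumes "0 \<le> \<delta>" and [measurable]: "U \<in> borel_measurable borel" and M: "\<And>X. \<bar>U X\<bar> \<le> M"
  shows "integrable lborel (\<lambda>Z. bump \<delta> (Z + H) * U (X - Z))"
proof -
  have "integrable (distr lborel borel ((+) H)) (bump \<delta> :: 'b \<Rightarrow> real)"
    using assms(1) by (simp add: lborel_distr_plus)
  then have "integrable lborel (\<lambda>Z. bump \<delta> (H + Z))"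
    by (subst (asm) integrable_distr_eq) auto
  then have "integrable lborel (\<lambda>Z. U (X - Z) * bump \<delta> (H + Z))"
    by (rule integrable_bounded_mult[where B = M]) (use M in auto)
  then show ?thesis by (simp add: mult.commute add.commute)
qed

section \<open>Difference estimates for the kernel\<close>

lemma pos_part_sq_diff:
  fixes a b B :: real
  assumes "a \<le> B" "b \<le> B" "0 \<le> B"
  shows "\<bar>(max 0 a)\<^sup>2 - (max 0 b)\<^sup>2\<bar> \<le> 2 * B * \<bar>a - b\<bar>"
proof -
  have "(max 0 a)\<^sup>2 - (max 0 b)\<^sup>2 = (max 0 a + max 0 b) * (max 0 a - max 0 b)"
    by (simp add: power2_eq_square algebra_simps)
  moreover have "\<bar>max 0 a - max 0 b\<bar> \<le> \<bar>a - b\<bar>" by (auto simp: max_def)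
  moreover have "\<bar>max 0 a + max 0 b\<bar> \<le> 2 * B" using assms by (auto simp: max_def)
  ultimately show ?thesis using assms(3) by (simp only: abs_mult) (rule mult_mono, auto)
qed

text \<open>The squared positive part has derivative \<open>2 * max 0 x\<close>, which is Lipschitz
  with constant 2, so the first order Taylor remainder is at most the squared increment.\<close>

lemma pos_part_sq_taylor:
  fixes a b :: real
  shows "\<bar>(max 0 a)\<^sup>2 - (max 0 b)\<^sup>2 - 2 * max 0 b * (a - b)\<bar> \<le> (a - b)\<^sup>2"
proof -
  consider "0 \<le> a" "0 \<le> b" | "a < 0" "0 \<le> b" | "0 \<le> a" "b < 0" | "a < 0" "b < 0" by linarith
  then show ?thesis
  proof cases
    case 1
    then have "(max 0 a)\<^sup>2 - (max 0 b)\<^sup>2 - 2 * max 0 b * (a - b) = (a - b)\<^sup>2"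
      by (simp add: power2_eq_square algebra_simps)
    then show ?thesis by simp
  next
    case 2
    then have "(max 0 a)\<^sup>2 - (max 0 b)\<^sup>2 - 2 * max 0 b * (a - b) = b\<^sup>2 - 2 * a * b"
      by (simp add: power2_eq_square algebra_simps)
    moreover have "0 \<le> b\<^sup>2 - 2 * a * b"
      using 2 mult_nonpos_nonneg[of a b] zero_le_power2[of b] by linarith
    moreover have "b\<^sup>2 - 2 * a * b \<le> (a - b)\<^sup>2" by (simp add: power2_eq_square algebra_simps)
    ultimately show ?thesis by simp
  next
    case 3
    then have "a\<^sup>2 \<le> (a - b)\<^sup>2" by (intro power_mono) auto
    with 3 show ?thesis by simp
  qed simp
qed

text \<open>The constant is \<open>2 * (\<delta> + 1) + 1\<close>, from Cauchy-Schwarz and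
  \<open>(norm H)\<^sup>2 \<le> norm H\<close>. The radius \<open>\<delta> + 1\<close> covers every
  point at which the kernel or its translate by \<open>H\<close> is nonzero.\<close>

lemma norm_sq_add_diff_le:
  fixes Y H :: "'b::euclidean_space"
  assumes "0 \<le> \<delta>" "norm Y \<le> \<delta> + 1" "norm H \<le> 1"
  shows "\<bar>(norm (Y + H))\<^sup>2 - (norm Y)\<^sup>2\<bar> \<le> (2 * \<delta> + 3) * norm H"
proof -
  have "(norm (Y + H))\<^sup>2 - (norm Y)\<^sup>2 = 2 * (Y \<bullet> H) + (norm H)\<^sup>2"
    by (simp add: power2_norm_eq_inner inner_add_left inner_add_right inner_commute)
  moreover have "\<bar>Y \<bullet> H\<bar> \<le> (\<delta> + 1) * norm H"
    using Cauchy_Schwarz_ineq2[of Y H] mult_right_mono[OF assms(2), of "norm H"] by simp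
  moreover have "(norm H)\<^sup>2 \<le> norm H"
    using mult_right_mono[OF assms(3), of "norm H"] by (simp add: power2_eq_square)
  moreover have "0 \<le> (norm H)\<^sup>2" by simp
  moreover have "(2 * \<delta> + 3) * norm H = 2 * ((\<delta> + 1) * norm H) + norm H"
    by (simp add: algebra_simps)
  ultimately show ?thesis by linarith
qed

lemma bump_diff_le:
  fixes Y H :: "'b::euclidean_space"
  assumes \<delta>: "0 \<le> \<delta>" and H: "norm H \<le> 1"
  shows "\<bar>bump \<delta> (Y + H) - bump \<delta> Y\<bar>
    \<le> 2 * \<delta>\<^sup>2 * (2 * \<delta> + 3) * norm H * indicator (cball 0 (\<delta> + 1)) Y"
proof (cases "norm Y \<le> \<delta> + 1")
  case True
  have "\<bar>bump \<delta> (Y + H) - bump \<delta> Y\<bar> \<le> 2 * \<delta>\<^sup>2 * \<bar>(norm (Y + H))\<^sup>2 - (norm Y)\<^sup>2\<bar>"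
    unfolding bump_def
    using pos_part_sq_diff[of "\<delta>\<^sup>2 - (norm (Y + H))\<^sup>2" "\<delta>\<^sup>2" "\<delta>\<^sup>2 - (norm Y)\<^sup>2"]
    by (simp add: abs_minus_commute)
  also have "\<dots> \<le> 2 * \<delta>\<^sup>2 * ((2 * \<delta> + 3) * norm H)"
    using norm_sq_add_diff_le[OF \<delta> True H] by (intro mult_left_mono) auto
  finally show ?thesis using True by (simp add: mult.assoc)
next
  case False
  then have "\<delta> \<le> norm (Y + H)" using H norm_diff_ineq[of Y H] by linarith
  then show ?thesis using False \<delta> by (simp add: bump_eq_0)
qed

text \<open>Both translates are Taylor expanded at the centre. The linear terms do not cancel but,
  by the parallelogram law, add up to order \<open>(norm H)\<^sup>2\<close>; they give
  \<open>4 * \<delta>\<^sup>2\<close>, and the two remainders give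
  \<open>2 * (2 * \<delta> + 3)\<^sup>2\<close>.\<close>

lemma bump_second_diff_le:
  fixes Y H :: "'b::euclidean_space"
  assumes \<delta>: "0 \<le> \<delta>" and H: "norm H \<le> 1"
  shows "\<bar>bump \<delta> (Y + H) + bump \<delta> (Y - H) - 2 * bump \<delta> Y\<bar>
    \<le> (2 * (2 * \<delta> + 3)\<^sup>2 + 4 * \<delta>\<^sup>2) * (norm H)\<^sup>2 * indicator (cball 0 (\<delta> + 1)) Y"
proof (cases "norm Y \<le> \<delta> + 1")
  case True
  define a where "a = \<delta>\<^sup>2 - (norm (Y + H))\<^sup>2"
  define a' where "a' = \<delta>\<^sup>2 - (norm (Y - H))\<^sup>2"
  define b where "b = \<delta>\<^sup>2 - (norm Y)\<^sup>2"
  have sq: "(c - b)\<^sup>2 \<le> (2 * \<delta> + 3)\<^sup>2 * (norm H)\<^sup>2" if "\<bar>c - b\<bar> \<le> (2 * \<delta> + 3) * norm H" for c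
    using power_mono[OF that, of 2] by (simp add: power_mult_distrib)
  have 1: "(a - b)\<^sup>2 \<le> (2 * \<delta> + 3)\<^sup>2 * (norm H)\<^sup>2"
    using norm_sq_add_diff_le[OF \<delta> True H] by (intro sq) (simp add: a_def b_def abs_minus_commute)
  have 2: "(a' - b)\<^sup>2 \<le> (2 * \<delta> + 3)\<^sup>2 * (norm H)\<^sup>2"
    using norm_sq_add_diff_le[OF \<delta> True, of "- H"] H by (intro sq) (simp add: a'_def b_def abs_minus_commute)
  have 3: "(a - b) + (a' - b) = - 2 * (norm H)\<^sup>2"
    unfolding a_def a'_def b_def
    by (simp add: power2_norm_eq_inner inner_add_left inner_add_right inner_diff_left inner_diff_right inner_commute)
  have 4: "2 * max 0 b * (a - b) + 2 * max 0 b * (a' - b) = - 4 * (max 0 b * (norm H)\<^sup>2)"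
    using arg_cong[OF 3, of "\<lambda>c. 2 * max 0 b * c"] by (simp add: algebra_simps)
  have 5: "max 0 b * (norm H)\<^sup>2 \<le> \<delta>\<^sup>2 * (norm H)\<^sup>2"
    by (intro mult_right_mono) (auto simp: b_def)
  have 6: "0 \<le> max 0 b * (norm H)\<^sup>2" by simp
  \<comment> \<open>Stated for abstract reals so that every product is an atom and only linear
    arithmetic remains.\<close>
  have "\<bar>p + p' - 2 * q\<bar> \<le> 2 * e + 4 * k'"
    if "\<bar>p - q - m\<bar> \<le> e" "\<bar>p' - q - m'\<bar> \<le> e" "m + m' = - 4 * k" "k \<le> k'" "0 \<le> k"
    for p p' q e k k' m m' :: real
    using that by linarith
  from this[OF order_trans[OF pos_part_sq_taylor 1] order_trans[OF pos_part_sq_taylor 2] 4 5 6]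
  have "\<bar>(max 0 a)\<^sup>2 + (max 0 a')\<^sup>2 - 2 * (max 0 b)\<^sup>2\<bar>
      \<le> 2 * ((2 * \<delta> + 3)\<^sup>2 * (norm H)\<^sup>2) + 4 * (\<delta>\<^sup>2 * (norm H)\<^sup>2)" .
  also have "\<dots> = (2 * (2 * \<delta> + 3)\<^sup>2 + 4 * \<delta>\<^sup>2) * (norm H)\<^sup>2"
    by (simp add: distrib_right)
  finally show ?thesis using True by (simp add: bump_def a_def a'_def b_def)
next
  case False
  then have "\<delta> \<le> norm (Y + H)" using H norm_diff_ineq[of Y H] by linarith
  moreover have "\<delta> \<le> norm (Y - H)" using H False norm_triangle_ineq2[of Y H] by linarith
  ultimately show ?thesis using False \<delta> by (simp add: bump_eq_0)
qed

text \<open>The translation moves from \<open>U\<close> onto the kernel, so that differences of the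
  mollification are controlled by those of \<open>bump\<close> and the bound on
  \<open>U\<close>.\<close>

lemma mollify_shift:
  fixes U :: "'b::euclidean_space \<Rightarrow> real"
  assumes [measurable]: "U \<in> borel_measurable borel"
  shows "mollify \<delta> U (X + H) = (LINT Z|lborel. bump \<delta> (Z + H) * U (X - Z))"
  unfolding mollify_def
  by (subst lborel_integral_affine[where c = 1 and t = H]) (auto simp: algebra_simps)

lemma mollify_bounded:
  fixes U :: "'b::euclidean_space \<Rightarrow> real"
  assumes "0 \<le> \<delta>" "U \<in> borel_measurable borel" and M: "\<And>X. \<bar>U X\<bar> \<le> M"
  shows "\<bar>mollify \<delta> U X\<bar> \<le> M * integral\<^sup>L lborel (bump \<delta> :: 'b \<Rightarrow> real)"
proof -
  have "\<bar>mollify \<delta> U X\<bar> \<le> (LINT Z|lborel. M * bump \<delta> (Z::'b))"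
    unfolding mollify_def
  proof (rule abs_integral_le)
    show "integrable lborel (\<lambda>Z. bump \<delta> Z * U (X - Z))"
      using integrable_bump_mult[OF assms, of 0 X] by simp
    show "\<bar>bump \<delta> Z * U (X - Z)\<bar> \<le> M * bump \<delta> Z" for Z
      using M[of "X - Z"] by (simp add: abs_mult mult.commute[of M] mult_left_mono)
  qed (use assms in auto)
  then show ?thesis by simp
qed

text \<open>Steps of length at most 1 use the kernel estimate, longer ones the bound
  \<open>2 * B \<le> 2 * B * norm H\<close>; the resulting constant is global.\<close>

lemma mollify_lipschitz:
  fixes U :: "'b::euclidean_space \<Rightarrow> real"
  assumes \<delta>: "0 \<le> \<delta>" and Um [measurable]: "U \<in> borel_measurable borel" and M: "\<And>X. \<bar>U X\<bar> \<le> M"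
  obtains L where "0 < L" "\<And>X Y. \<bar>mollify \<delta> U X - mollify \<delta> U Y\<bar> \<le> L * dist X Y"
proof -
  have M0: "0 \<le> M" using M[of 0] by linarith
  define B where "B = M * integral\<^sup>L lborel (bump \<delta> :: 'b \<Rightarrow> real)"
  have B: "\<bar>mollify \<delta> U X\<bar> \<le> B" for X unfolding B_def by (rule mollify_bounded[OF assms])
  have B0: "0 \<le> B" using B[of 0] by linarith
  define K where "K = 2 * \<delta>\<^sup>2 * (2 * \<delta> + 3)"
  define V where "V = (LINT Z|lborel. indicat_real (cball 0 (\<delta> + 1)) (Z::'b))"
  have K0: "0 \<le> K * V * M" using \<delta> M0 by (simp add: K_def V_def)
  have est: "\<bar>mollify \<delta> U (Y + H) - mollify \<delta> U Y\<bar> \<le> (K * V * M + 2 * B) * norm H" for Y H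
  proof (cases "norm H \<le> 1")
    case True
    have "\<bar>mollify \<delta> U (Y + H) - mollify \<delta> U Y\<bar>
        = \<bar>LINT Z|lborel. bump \<delta> (Z + H) * U (Y - Z) - bump \<delta> (Z + 0) * U (Y - Z)\<bar>"
      using mollify_shift[OF Um, of \<delta> Y 0] integrable_bump_mult[OF assms, of H Y]
        integrable_bump_mult[OF assms, of 0 Y]
      by (subst Bochner_Integration.integral_diff) (auto simp: mollify_shift[OF Um])
    also have "\<dots> \<le> (LINT Z|lborel. K * norm H * M * indicator (cball 0 (\<delta> + 1)) (Z::'b))"
    proof (rule abs_integral_le)
      fix Z
      have "\<bar>(bump \<delta> (Z + H) - bump \<delta> Z) * U (Y - Z)\<bar>
          \<le> (K * norm H * indicator (cball 0 (\<delta> + 1)) Z) * M"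
        unfolding abs_mult K_def using bump_diff_le[OF \<delta> True, of Z] M \<delta> by (intro mult_mono) auto
      then show "\<bar>bump \<delta> (Z + H) * U (Y - Z) - bump \<delta> (Z + 0) * U (Y - Z)\<bar>
          \<le> K * norm H * M * indicator (cball 0 (\<delta> + 1)) Z"
        by (simp add: algebra_simps)
    qed (use integrable_bump_mult[OF assms, of H Y] integrable_bump_mult[OF assms, of 0 Y] in auto)
    also have "\<dots> = K * V * M * norm H" by (simp add: V_def)
    also have "\<dots> \<le> (K * V * M + 2 * B) * norm H"
      using B0 by (intro mult_right_mono) auto
    finally show ?thesis .
  next
    case False
    have "\<bar>mollify \<delta> U (Y + H) - mollify \<delta> U Y\<bar> \<le> 2 * B" using B[of "Y + H"] B[of Y] by linarith
    also have "\<dots> \<le> 2 * B * norm H" using False B0 mult_left_mono[of 1 "norm H" "2 * B"] by simp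
    also have "\<dots> \<le> (K * V * M + 2 * B) * norm H"
      using K0 by (intro mult_right_mono) auto
    finally show ?thesis .
  qed
  \<comment> \<open>The summand 1 makes the constant positive even if \<open>M = 0\<close>; the
    radius in \<open>near_sup_propagates\<close> divides by such a constant.\<close>
  have "\<bar>mollify \<delta> U X - mollify \<delta> U Y\<bar> \<le> (K * V * M + 2 * B + 1) * dist X Y" for X Y
  proof -
    have "\<bar>mollify \<delta> U X - mollify \<delta> U Y\<bar> \<le> (K * V * M + 2 * B) * dist X Y"
      using est[of Y "X - Y"] by (simp add: dist_norm)
    also have "\<dots> \<le> (K * V * M + 2 * B + 1) * dist X Y"
      by (intro mult_right_mono) auto
    finally show ?thesis .
  qed
  moreover have "0 < K * V * M + 2 * B + 1" using K0 B0 by linarith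
  ultimately show ?thesis by (rule that[rotated])
qed

text \<open>As for the Lipschitz bound, with long steps costing \<open>4 * B\<close> because the
  coefficients of a second difference have absolute sum 4.\<close>

lemma mollify_second_diff:
  fixes U :: "'b::euclidean_space \<Rightarrow> real"
  assumes \<delta>: "0 \<le> \<delta>" and Um [measurable]: "U \<in> borel_measurable borel" and M: "\<And>X. \<bar>U X\<bar> \<le> M"
  obtains C where "0 \<le> C"
    "\<And>X H. \<bar>mollify \<delta> U (X + H) + mollify \<delta> U (X - H) - 2 * mollify \<delta> U X\<bar> \<le> C * (norm H)\<^sup>2"
proof -
  have M0: "0 \<le> M" using M[of 0] by linarith
  define B where "B = M * integral\<^sup>L lborel (bump \<delta> :: 'b \<Rightarrow> real)"
  have B: "\<bar>mollify \<delta> U X\<bar> \<le> B" for X unfolding B_def by (rule mollify_bounded[OF assms])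
  have B0: "0 \<le> B" using B[of 0] by linarith
  define K where "K = 2 * (2 * \<delta> + 3)\<^sup>2 + 4 * \<delta>\<^sup>2"
  define V where "V = (LINT Z|lborel. indicat_real (cball 0 (\<delta> + 1)) (Z::'b))"
  have K0: "0 \<le> K * V * M" using \<delta> M0 by (simp add: K_def V_def)
  have est: "\<bar>mollify \<delta> U (Y + H) + mollify \<delta> U (Y - H) - 2 * mollify \<delta> U Y\<bar> \<le> (K * V * M + 4 * B) * (norm H)\<^sup>2" for Y H
  proof (cases "norm H \<le> 1")
    case True
    have i: "integrable lborel (\<lambda>Z. bump \<delta> (Z + H') * U (Y - Z))" for H'
      by (rule integrable_bump_mult[OF assms])
    have i': "integrable lborel (\<lambda>Z. bump \<delta> (Z + H) * U (Y - Z) + bump \<delta> (Z - H) * U (Y - Z) - 2 * (bump \<delta> Z * U (Y - Z)))"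
      using i[of H] i[of "- H"] i[of 0] by simp
    have "mollify \<delta> U (Y + H) + mollify \<delta> U (Y - H) - 2 * mollify \<delta> U Y
        = (LINT Z|lborel. bump \<delta> (Z + H) * U (Y - Z) + bump \<delta> (Z - H) * U (Y - Z) - 2 * (bump \<delta> Z * U (Y - Z)))"
      using mollify_shift[OF Um, of \<delta> Y 0] mollify_shift[OF Um, of \<delta> Y H] mollify_shift[OF Um, of \<delta> Y "- H"]
        i[of H] i[of "- H"] i[of 0] by simp
    then have "\<bar>mollify \<delta> U (Y + H) + mollify \<delta> U (Y - H) - 2 * mollify \<delta> U Y\<bar>
        = \<bar>LINT Z|lborel. bump \<delta> (Z + H) * U (Y - Z) + bump \<delta> (Z - H) * U (Y - Z) - 2 * (bump \<delta> Z * U (Y - Z))\<bar>"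
      by simp
    also have "\<dots> \<le> (LINT Z|lborel. K * (norm H)\<^sup>2 * M * indicator (cball 0 (\<delta> + 1)) (Z::'b))"
    proof (rule abs_integral_le)
      fix Z
      have "\<bar>(bump \<delta> (Z + H) + bump \<delta> (Z - H) - 2 * bump \<delta> Z) * U (Y - Z)\<bar>
          \<le> (K * (norm H)\<^sup>2 * indicator (cball 0 (\<delta> + 1)) Z) * M"
        unfolding abs_mult K_def using bump_second_diff_le[OF \<delta> True, of Z] M \<delta> by (intro mult_mono) auto
      then show "\<bar>bump \<delta> (Z + H) * U (Y - Z) + bump \<delta> (Z - H) * U (Y - Z) - 2 * (bump \<delta> Z * U (Y - Z))\<bar>
          \<le> K * (norm H)\<^sup>2 * M * indicator (cball 0 (\<delta> + 1)) Z"
        by (simp add: algebra_simps)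
    qed (use i' in auto)
    also have "\<dots> = K * V * M * (norm H)\<^sup>2" by (simp add: V_def)
    also have "\<dots> \<le> (K * V * M + 4 * B) * (norm H)\<^sup>2"
      using B0 by (intro mult_right_mono) auto
    finally show ?thesis .
  next
    case False
    have "\<bar>mollify \<delta> U (Y + H) + mollify \<delta> U (Y - H) - 2 * mollify \<delta> U Y\<bar> \<le> 4 * B"
      using B[of "Y + H"] B[of "Y - H"] B[of Y] by linarith
    also have "\<dots> \<le> 4 * B * (norm H)\<^sup>2"
      using False B0 mult_left_mono[of 1 "(norm H)\<^sup>2" "4 * B"] one_le_power[of "norm H" 2] by simp
    also have "\<dots> \<le> (K * V * M + 4 * B) * (norm H)\<^sup>2"
      using K0 by (intro mult_right_mono) auto
    finally show ?thesis .
  qed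
  moreover have "0 \<le> K * V * M + 4 * B" using K0 B0 by linarith
  ultimately show ?thesis by (rule that[rotated])
qed

section \<open>Mollification preserves the equation\<close>

lemma heat_defect_mollify:
  fixes U :: "'a::euclidean_space \<times> real \<Rightarrow> real"
  assumes \<delta>: "0 \<le> \<delta>" and Um [measurable]: "U \<in> borel_measurable borel" and M: "\<And>X. \<bar>U X\<bar> \<le> M"
  shows "heat_defect (mollify \<delta> U) X r = (LINT Z|lborel. bump \<delta> Z * heat_defect U (X - Z) r)"
proof -
  let ?\<zeta> = "\<lambda>w. (sqrt r *\<^sub>R w, - r) :: 'a \<times> real"
  have i: "integrable lborel (\<lambda>Z. bump \<delta> Z * U (Y - Z))" for Y
    using integrable_bump_mult[OF assms, of 0 Y] by simp
  have "heat_defect (mollify \<delta> U) X r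
      = (LINT w|lborel. (LINT Z|lborel. bump \<delta> Z * ((U (X - Z) - U (X - Z + ?\<zeta> w)) * gauss w)))"
    unfolding heat_defect_def
  proof (intro Bochner_Integration.integral_cong refl)
    fix w :: 'a
    have "mollify \<delta> U X - mollify \<delta> U (X + ?\<zeta> w)
        = (LINT Z|lborel. bump \<delta> Z * U (X - Z) - bump \<delta> Z * U (X + ?\<zeta> w - Z))"
      unfolding mollify_def using i by (simp only: Bochner_Integration.integral_diff)
    also have "\<dots> * gauss w = (LINT Z|lborel. (bump \<delta> Z * U (X - Z) - bump \<delta> Z * U (X + ?\<zeta> w - Z)) * gauss w)"
      by (rule integral_mult_left_zero[symmetric])
    also have "\<dots> = (LINT Z|lborel. bump \<delta> Z * ((U (X - Z) - U (X - Z + ?\<zeta> w)) * gauss w))"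
      by (intro Bochner_Integration.integral_cong refl) (simp add: algebra_simps)
    finally show "(mollify \<delta> U X - mollify \<delta> U (X + ?\<zeta> w)) * gauss w
      = (LINT Z|lborel. bump \<delta> Z * ((U (X - Z) - U (X - Z + ?\<zeta> w)) * gauss w))" .
  qed
  also have "\<dots> = (LINT Z|lborel. (LINT w|lborel. bump \<delta> Z * ((U (X - Z) - U (X - Z + ?\<zeta> w)) * gauss w)))"
  proof (rule Fubini_lborel_dominated[where f = "\<lambda>Z. 2 * M * bump \<delta> Z" and g = gauss])
    fix Z w
    have "\<bar>U (X - Z) - U (X - Z + ?\<zeta> w)\<bar> \<le> 2 * M"
      using M[of "X - Z"] M[of "X - Z + ?\<zeta> w"] by linarith
    then have "\<bar>U (X - Z) - U (X - Z + ?\<zeta> w)\<bar> * (bump \<delta> Z * gauss w) \<le> 2 * M * (bump \<delta> Z * gauss w)"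
      by (rule mult_right_mono) simp
    then show "\<bar>bump \<delta> Z * ((U (X - Z) - U (X - Z + ?\<zeta> w)) * gauss w)\<bar> \<le> 2 * M * bump \<delta> Z * gauss w"
      by (simp add: abs_mult mult_ac)
  qed (use \<delta> in auto)
  also have "\<dots> = (LINT Z|lborel. bump \<delta> Z * heat_defect U (X - Z) r)"
    by (simp add: heat_defect_def)
  finally show ?thesis .
qed

text \<open>Centres \<open>X - Z\<close> with \<open>bump \<delta> Z\<close> nonzero lie in
  \<open>cball X \<delta>\<close>, so a constant valid on this ball alone yields a dominating
  function for the exchange of integrals.\<close>

lemma mollify_jump_integral_eq_0:
  fixes U :: "'a::euclidean_space \<times> real \<Rightarrow> real"
  assumes \<delta>: "0 \<le> \<delta>" and Um [measurable]: "U \<in> borel_measurable borel" and M: "\<And>X. \<bar>U X\<bar> \<le> M"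
    and s: "0 < s" "s < \<beta>"
    and C: "0 \<le> C" "\<And>Y r. Y \<in> cball X \<delta> \<Longrightarrow> 0 < r \<Longrightarrow> \<bar>heat_defect U Y r\<bar> \<le> C * r powr \<beta>"
    and eq: "\<And>Y. (LINT r|lborel. jump s r * heat_defect U Y r) = 0"
  shows "(LINT r|lborel. jump s r * heat_defect (mollify \<delta> U) X r) = 0"
proof -
  define A where "A = 2 * M * (LINT w|lborel. gauss (w::'a))"
  have A: "\<bar>heat_defect U Y r\<bar> \<le> A" for Y r
    unfolding A_def by (rule heat_defect_bounded[OF Um M])
  have A0: "0 \<le> A" using A[of 0 0] by linarith
  have "(LINT r|lborel. jump s r * heat_defect (mollify \<delta> U) X r)
      = (LINT r|lborel. (LINT Z|lborel. jump s r * (bump \<delta> Z * heat_defect U (X - Z) r)))"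
    unfolding heat_defect_mollify[OF \<delta> Um M] by simp
  also have "\<dots> = (LINT Z|lborel. (LINT r|lborel. jump s r * (bump \<delta> Z * heat_defect U (X - Z) r)))"
  proof (rule Fubini_lborel_dominated[where f = "bump \<delta>" and g = "\<lambda>r. min A (C * r powr \<beta>) * jump s r"])
    show "integrable lborel (\<lambda>r. min A (C * r powr \<beta>) * jump s r)"
      using s A0 C by (intro integrable_jump_min)
    fix Z :: "'a \<times> real" and r :: real
    show "\<bar>jump s r * (bump \<delta> Z * heat_defect U (X - Z) r)\<bar> \<le> bump \<delta> Z * (min A (C * r powr \<beta>) * jump s r)"
    proof (cases "r > 0 \<and> norm Z < \<delta>")
      case True
      then have "\<bar>heat_defect U (X - Z) r\<bar> \<le> min A (C * r powr \<beta>)"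
        using A C(2)[of "X - Z" r] by (simp add: dist_norm)
      then have "\<bar>heat_defect U (X - Z) r\<bar> * (jump s r * bump \<delta> Z) \<le> min A (C * r powr \<beta>) * (jump s r * bump \<delta> Z)"
        by (rule mult_right_mono) simp
      then show ?thesis by (simp add: abs_mult mult_ac)
    next
      case False
      then have "jump s r = 0 \<or> bump \<delta> Z = 0" using \<delta> by (auto simp: jump_def bump_eq_0)
      then show ?thesis by auto
    qed
  qed (use \<delta> in auto)
  also have "\<dots> = (LINT Z|lborel. bump \<delta> Z * (LINT r|lborel. jump s r * heat_defect U (X - Z) r))"
    by (simp add: mult.left_commute[of "jump s _"])
  finally show ?thesis by (simp add: eq)
qed

text \<open>No limit in the scale is taken: if \<open>U X < U Y\<close>, continuity keeps
  \<open>U (X - Z) < U (Y - Z)\<close> for \<open>norm Z < \<delta>\<close>, and the mollification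
  at this single scale already separates \<open>X\<close> from \<open>Y\<close>.\<close>

lemma mollify_const_imp_const:
  fixes U :: "'b::euclidean_space \<Rightarrow> real"
  assumes cont: "continuous_on UNIV U" and M: "\<And>X. \<bar>U X\<bar> \<le> M"
    and const: "\<And>\<delta> X Y. 0 < \<delta> \<Longrightarrow> mollify \<delta> U X = mollify \<delta> U Y"
  shows "U X = U Y"
proof -
  have Um [measurable]: "U \<in> borel_measurable borel"
    using cont by (rule borel_measurable_continuous_onI)
  have "\<not> U X < U Y" for X Y
  proof
    assume less: "U X < U Y"
    have "continuous_on UNIV (\<lambda>Z. U (Y - Z) - U (X - Z))"
      by (intro continuous_intros continuous_on_compose2[OF cont]) auto
    then have "isCont (\<lambda>Z. U (Y - Z) - U (X - Z)) 0"
      by (simp add: continuous_on_eq_continuous_at)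
    then have "((\<lambda>Z. U (Y - Z) - U (X - Z)) \<longlongrightarrow> U (Y - 0) - U (X - 0)) (nhds 0)"
      unfolding continuous_at by (subst (asm) tendsto_at_iff_tendsto_nhds)
    then have "eventually (\<lambda>Z. 0 < U (Y - Z) - U (X - Z)) (nhds 0)"
      using less by (intro order_tendstoD(1)[of _ "U (Y - 0) - U (X - 0)"]) auto
    then obtain \<delta> where \<delta>: "0 < \<delta>" "\<And>Z. norm Z < \<delta> \<Longrightarrow> 0 < U (Y - Z) - U (X - Z)"
      by (auto simp: eventually_nhds_metric)
    have i: "integrable lborel (\<lambda>Z. bump \<delta> Z * U (W - Z))" for W
      using integrable_bump_mult[OF _ Um M, of \<delta> 0 W] \<delta> by simp
    have "0 < (LINT Z|lborel. bump \<delta> Z * U (Y - Z) - bump \<delta> Z * U (X - Z))"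
    proof (rule integral_pos_on_open[where A = "ball 0 \<delta>"])
      show "0 \<le> bump \<delta> Z * U (Y - Z) - bump \<delta> Z * U (X - Z)" for Z
        using \<delta> by (cases "norm Z < \<delta>") (auto simp: bump_eq_0 less_imp_le intro!: mult_left_mono)
      show "0 < bump \<delta> Z * U (Y - Z) - bump \<delta> Z * U (X - Z)" if "Z \<in> ball 0 \<delta>" for Z
        using \<delta>(2)[of Z] bump_pos[of Z \<delta>] that by simp
    qed (use \<delta> i in auto)
    also have "\<dots> = mollify \<delta> U Y - mollify \<delta> U X"
      using i by (simp add: mollify_def)
    finally show False using const[OF \<delta>(1), of X Y] by simp
  qed
  then show ?thesis by (meson linorder_neqE)
qed

text \<open>Two exponents occur. \<beta> belongs to \<open>U\<close>, has locally uniform constants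
  and serves to exchange integrals; the mollification has exponent 1 with global constants,
  admissible in \<open>liouville_lipschitz\<close> because \<open>s < 1\<close>.\<close>

lemma liouville_heat_defect:
  fixes U :: "'a::euclidean_space \<times> real \<Rightarrow> real"
  assumes s: "0 < s" "s < 1" "s < \<beta>"
    and cont: "continuous_on UNIV U" and M: "\<And>X. \<bar>U X\<bar> \<le> M"
    and loc: "\<And>X \<delta>. \<exists>C\<ge>0. \<forall>Y\<in>cball X \<delta>. \<forall>r>0. \<bar>heat_defect U Y r\<bar> \<le> C * r powr \<beta>"
    and eq: "\<And>Y. (LINT r|lborel. jump s r * heat_defect U Y r) = 0"
  shows "U X = U Y"
proof (rule mollify_const_imp_const[OF cont M])
  fix \<delta> :: real and X Y assume "0 < \<delta>"
  then have \<delta>: "0 \<le> \<delta>" by simp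
  have Um [measurable]: "U \<in> borel_measurable borel"
    using cont by (rule borel_measurable_continuous_onI)
  define v where "v = mollify \<delta> U"
  obtain L where L: "0 < L" "\<And>X Y. \<bar>v X - v Y\<bar> \<le> L * dist X Y"
    unfolding v_def using mollify_lipschitz[OF \<delta> Um M] by blast
  obtain K where K: "0 \<le> K" "\<And>X H. \<bar>v (X + H) + v (X - H) - 2 * v X\<bar> \<le> K * (norm H)\<^sup>2"
    unfolding v_def using mollify_second_diff[OF \<delta> Um M] by blast
  define B where "B = M * integral\<^sup>L lborel (bump \<delta> :: 'a \<times> real \<Rightarrow> real)"
  have B: "\<bar>v X\<bar> \<le> B" for X unfolding v_def B_def by (rule mollify_bounded[OF \<delta> Um M])
  have "L-lipschitz_on UNIV v"
    using L by (intro lipschitz_onI) (auto simp: dist_real_def)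
  then have vm: "v \<in> borel_measurable borel"
    by (intro borel_measurable_continuous_onI lipschitz_on_continuous_on)
  \<comment> \<open>\<open>K\<close> bounds the spatial second difference at time
    \<open>t - r\<close>; \<open>2 * L\<close> pays for replacing \<open>2 * v (x, t - r)\<close> by
    \<open>2 * v (x, t)\<close>.\<close>
  define C where "C = (K + 2 * L) * (LINT w|lborel. (2 + (norm w)\<^sup>2) * gauss (w::'a))"
  have hd: "\<bar>heat_defect v X r\<bar> \<le> C * r powr 1" if r: "0 < r" for X r
  proof -
    obtain x t where X: "X = (x, t)" by (cases X)
    show ?thesis unfolding X C_def
    proof (rule heat_defect_le_powr[OF vm B _ _ _ r])
      fix h :: 'a
      have "\<bar>v (x + h, t - r) + v (x - h, t - r) - 2 * v (x, t - r)\<bar> \<le> K * (norm h)\<^sup>2"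
        using K(2)[of "(x, t - r)" "(h, 0)"] by simp
      moreover have "\<bar>v (x, t - r) - v (x, t)\<bar> \<le> L * r"
        using L(2)[of "(x, t - r)" "(x, t)"] r by (simp add: dist_Pair_Pair dist_real_def)
      moreover have "0 \<le> 2 * L * (norm h)\<^sup>2" "0 \<le> K * r" using K L r by auto
      moreover have "norm h powr (2 * 1) = (norm h)\<^sup>2"
        by simp
      ultimately show "\<bar>v (x + h, t - r) + v (x - h, t - r) - 2 * v (x, t)\<bar>
          \<le> (K + 2 * L) * (norm h powr (2 * 1) + r powr 1)"
        using r by (simp add: algebra_simps)
    qed (use K L in auto)
  qed
  have "0 \<le> (LINT w|lborel. (2 + (norm w)\<^sup>2) * gauss (w::'a))" by simp
  then have C0: "0 \<le> C" unfolding C_def using K L by simp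
  have "v X = v Y"
  proof (rule liouville_lipschitz[OF s(1,2) B L C0 hd])
    fix X
    obtain C' where "0 \<le> C'" "\<And>Y r. Y \<in> cball X \<delta> \<Longrightarrow> 0 < r \<Longrightarrow> \<bar>heat_defect U Y r\<bar> \<le> C' * r powr \<beta>"
      using loc[of X \<delta>] by blast
    then show "(LINT r|lborel. jump s r * heat_defect v X r) = 0"
      unfolding v_def by (intro mollify_jump_integral_eq_0[OF \<delta> Um M s(1,3) _ _ eq])
  qed
  then show "mollify \<delta> U X = mollify \<delta> U Y" by (simp add: v_def)
qed

subsection \<open>Local Hoelder regularity\<close>

text \<open>The time modulus, uniform in space on boxes, handles \<open>f y \<tau> - f y t\<close>;
  continuity in space at the single time \<open>t\<close> handles
  \<open>f y t - f x t\<close>.\<close>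

lemma time_hoelder_imp_continuous:
  fixes f :: "'a::euclidean_space \<Rightarrow> real \<Rightarrow> real"
  assumes \<alpha>: "0 < \<alpha>" and cx: "\<And>x t. isCont (\<lambda>x. f x t) x"
    and hoel: "\<And>R. \<exists>C. \<forall>x t \<tau>. norm x \<le> R \<longrightarrow> \<bar>t\<bar> \<le> R \<longrightarrow> \<bar>\<tau>\<bar> \<le> R \<longrightarrow> \<bar>f x t - f x \<tau>\<bar> \<le> C * \<bar>t - \<tau>\<bar> powr \<alpha>"
  shows "continuous_on UNIV (case_prod f)"
proof -
  have "isCont (case_prod f) (x, t)" for x t
  proof -
    define R where "R = norm x + \<bar>t\<bar> + 1"
    obtain C where C: "\<And>x t \<tau>. norm x \<le> R \<Longrightarrow> \<bar>t\<bar> \<le> R \<Longrightarrow> \<bar>\<tau>\<bar> \<le> R \<Longrightarrow> \<bar>f x t - f x \<tau>\<bar> \<le> C * \<bar>t - \<tau>\<bar> powr \<alpha>"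
      using hoel[of R] by blast
    define g where "g p = C * \<bar>snd p - t\<bar> powr \<alpha> + \<bar>f (fst p) t - f x t\<bar>" for p
    have f1: "(fst \<longlongrightarrow> x) (at (x, t))" and s1: "(snd \<longlongrightarrow> t) (at (x, t))"
      using tendsto_fst[OF tendsto_ident_at] tendsto_snd[OF tendsto_ident_at] by fastforce+
    have "((\<lambda>p. \<bar>snd p - t\<bar> powr \<alpha>) \<longlongrightarrow> \<bar>t - t\<bar> powr \<alpha>) (at (x, t))"
      using \<alpha> by (intro tendsto_powr2 tendsto_intros s1) auto
    moreover have "((\<lambda>p. f (fst p) t) \<longlongrightarrow> f x t) (at (x, t))"
      by (rule isCont_tendsto_compose[OF cx f1])
    ultimately have "(g \<longlongrightarrow> C * \<bar>t - t\<bar> powr \<alpha> + \<bar>f x t - f x t\<bar>) (at (x, t))"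
      unfolding g_def by (intro tendsto_add tendsto_mult_left tendsto_rabs tendsto_diff tendsto_const)
    then have g0: "(g \<longlongrightarrow> 0) (at (x, t))" using \<alpha> by simp
    have "eventually (\<lambda>p. dist p (x, t) < 1) (at (x, t))"
      by (auto simp: eventually_at intro: exI[of _ 1])
    then have "eventually (\<lambda>p. norm (case_prod f p - f x t) \<le> g p) (at (x, t))"
    proof eventually_elim
      case (elim p)
      obtain y \<tau> where p: "p = (y, \<tau>)" by (cases p)
      have "dist y x < 1" "dist \<tau> t < 1"
        using elim dist_fst_le[of p "(x, t)"] dist_snd_le[of p "(x, t)"] unfolding p by auto
      then have "norm y \<le> R" "\<bar>\<tau>\<bar> \<le> R" "\<bar>t\<bar> \<le> R"
        using norm_triangle_ineq2[of y x] norm_ge_zero[of x] unfolding R_def dist_norm real_norm_def by linarith+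
      then show ?case using C[of y \<tau> t] by (simp add: p g_def)
    qed
    then have "((\<lambda>p. case_prod f p - f x t) \<longlongrightarrow> 0) (at (x, t))"
      by (rule Lim_null_comparison) (rule g0)
    then show ?thesis by (simp add: isCont_def LIM_zero_iff)
  qed
  then show ?thesis by (auto simp: continuous_on_eq_continuous_at)
qed

lemma continuous_bounded_on_box:
  fixes f :: "'a::euclidean_space \<Rightarrow> real \<Rightarrow> real"
  assumes "continuous_on UNIV (case_prod f)"
  obtains B where "0 \<le> B" "\<And>x t. norm x \<le> R \<Longrightarrow> \<bar>t\<bar> \<le> R \<Longrightarrow> \<bar>f x t\<bar> \<le> B"
proof -
  have "compact (cball (0::'a) R \<times> cball (0::real) R)" by (intro compact_Times compact_cball)
  then have "bounded (case_prod f ` (cball 0 R \<times> cball 0 R))"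
    using assms by (intro compact_imp_bounded compact_continuous_image) (auto intro: continuous_on_subset)
  then obtain B where B: "0 < B" "\<And>z. z \<in> case_prod f ` (cball 0 R \<times> cball 0 R) \<Longrightarrow> norm z \<le> B"
    unfolding bounded_pos by blast
  show ?thesis
  proof (rule that[of B])
    fix x :: 'a and t :: real assume "norm x \<le> R" "\<bar>t\<bar> \<le> R"
    then show "\<bar>f x t\<bar> \<le> B" using B(2)[of "f x t"] by force
  qed (use B in simp)
qed

lemma time_derivative_imp_lipschitz:
  fixes u :: "'a::euclidean_space \<Rightarrow> real \<Rightarrow> real"
  assumes der: "\<And>x t. ((\<lambda>\<tau>. u x \<tau>) has_real_derivative ut x t) (at t)"
    and cont: "continuous_on UNIV (case_prod ut)"
  shows "\<exists>C. \<forall>x t \<tau>. norm x \<le> R \<longrightarrow> \<bar>t\<bar> \<le> R \<longrightarrow> \<bar>\<tau>\<bar> \<le> R \<longrightarrow> \<bar>u x t - u x \<tau>\<bar> \<le> C * \<bar>t - \<tau>\<bar> powr 1"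
proof -
  obtain B where B: "0 \<le> B" "\<And>x t. norm x \<le> R \<Longrightarrow> \<bar>t\<bar> \<le> R \<Longrightarrow> \<bar>ut x t\<bar> \<le> B"
    using continuous_bounded_on_box[OF cont] by blast
  have "\<bar>u x t - u x \<tau>\<bar> \<le> B * \<bar>t - \<tau>\<bar> powr 1" if "norm x \<le> R" "\<bar>t\<bar> \<le> R" "\<bar>\<tau>\<bar> \<le> R" for x t \<tau>
  proof -
    have "norm (u x t - u x \<tau>) \<le> B * norm (t - \<tau>)"
    proof (rule field_differentiable_bound[of "cball 0 R"])
      show "(u x has_field_derivative ut x z) (at z within cball 0 R)" for z
        using der[of x z] by (rule has_field_derivative_at_within)
    qed (use that B in auto)
    then show ?thesis by simp
  qed
  then show ?thesis by blast
qed

lemma hoelder_base_low: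
  fixes u :: "'a::euclidean_space \<Rightarrow> real \<Rightarrow> real"
  assumes "hoelder_base \<alpha> u" "\<alpha> \<le> 1/2"
  shows "\<exists>C\<ge>0. \<forall>x t y \<tau>. norm x \<le> R \<longrightarrow> \<bar>t\<bar> \<le> R \<longrightarrow> norm y \<le> R \<longrightarrow> \<bar>\<tau>\<bar> \<le> R \<longrightarrow>
    \<bar>u x t - u y \<tau>\<bar> \<le> C * (norm (x - y) + sqrt \<bar>t - \<tau>\<bar>) powr (2 * \<alpha>)"
proof -
  have "compact (cball (0::'a) R \<times> cball (0::real) R)" by (intro compact_Times compact_cball)
  with assms obtain C where C: "\<forall>(x,t)\<in>cball (0::'a) R \<times> cball (0::real) R. \<forall>(y,\<tau>)\<in>cball 0 R \<times> cball 0 R.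
             \<bar>u x t - u y \<tau>\<bar> \<le> C * (norm (x - y) + sqrt \<bar>t - \<tau>\<bar>) powr (2 * \<alpha>)"
    unfolding hoelder_base_def by auto
  have "\<bar>u x t - u y \<tau>\<bar> \<le> \<bar>C\<bar> * (norm (x - y) + sqrt \<bar>t - \<tau>\<bar>) powr (2 * \<alpha>)"
    if "norm x \<le> R" "\<bar>t\<bar> \<le> R" "norm y \<le> R" "\<bar>\<tau>\<bar> \<le> R" for x t y \<tau>
  proof -
    have "\<bar>u x t - u y \<tau>\<bar> \<le> C * (norm (x - y) + sqrt \<bar>t - \<tau>\<bar>) powr (2 * \<alpha>)"
      using C that by fastforce
    also have "\<dots> \<le> \<bar>C\<bar> * (norm (x - y) + sqrt \<bar>t - \<tau>\<bar>) powr (2 * \<alpha>)"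
      by (intro mult_right_mono) auto
    finally show ?thesis .
  qed
  then show ?thesis by (intro exI[of _ "\<bar>C\<bar>"]) auto
qed

lemma hoelder_base_high:
  fixes u :: "'a::euclidean_space \<Rightarrow> real \<Rightarrow> real"
  assumes "hoelder_base \<alpha> u" "\<alpha> > 1/2"
  obtains Du :: "'a \<Rightarrow> real \<Rightarrow> 'a" where
    "\<And>x t. ((\<lambda>y. u y t) has_derivative (\<lambda>h. Du x t \<bullet> h)) (at x)"
    "\<And>R. \<exists>C\<ge>0. (\<forall>x t \<tau>. norm x \<le> R \<longrightarrow> \<bar>t\<bar> \<le> R \<longrightarrow> \<bar>\<tau>\<bar> \<le> R \<longrightarrow> \<bar>u x t - u x \<tau>\<bar> \<le> C * \<bar>t - \<tau>\<bar> powr \<alpha>) \<and>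
      (\<forall>x y t. norm x \<le> R \<longrightarrow> norm y \<le> R \<longrightarrow> \<bar>t\<bar> \<le> R \<longrightarrow> norm (Du x t - Du y t) \<le> C * norm (x - y) powr (2 * \<alpha> - 1))"
proof -
  from assms obtain Du :: "'a \<Rightarrow> real \<Rightarrow> 'a" where
    D: "\<And>x t. ((\<lambda>y. u y t) has_derivative (\<lambda>h. Du x t \<bullet> h)) (at x)" and
    H: "\<And>K::('a \<times> real) set. compact K \<Longrightarrow>
             (\<exists>C. (\<forall>x t \<tau>. (x,t) \<in> K \<longrightarrow> (x,\<tau>) \<in> K \<longrightarrow>
                     \<bar>u x t - u x \<tau>\<bar> \<le> C * \<bar>t - \<tau>\<bar> powr \<alpha> \<and>
                     norm (Du x t - Du x \<tau>) \<le> C * \<bar>t - \<tau>\<bar> powr (\<alpha> - 1/2)) \<and>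
                  (\<forall>x y t. (x,t) \<in> K \<longrightarrow> (y,t) \<in> K \<longrightarrow>
                     norm (Du x t - Du y t) \<le> C * norm (x - y) powr (2 * \<alpha> - 1)))"
    unfolding hoelder_base_def by auto
  have abs: "C * z powr a \<le> \<bar>C\<bar> * z powr a" for C z a :: real
    by (intro mult_right_mono) auto
  show ?thesis
  proof (rule that[OF D])
    fix R :: real
    have "compact (cball (0::'a) R \<times> cball (0::real) R)" by (intro compact_Times compact_cball)
    from H[OF this] obtain C where C:
      "\<And>x t \<tau>. norm x \<le> R \<Longrightarrow> \<bar>t\<bar> \<le> R \<Longrightarrow> \<bar>\<tau>\<bar> \<le> R \<Longrightarrow> \<bar>u x t - u x \<tau>\<bar> \<le> C * \<bar>t - \<tau>\<bar> powr \<alpha>"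
      "\<And>x y t. norm x \<le> R \<Longrightarrow> norm y \<le> R \<Longrightarrow> \<bar>t\<bar> \<le> R \<Longrightarrow> norm (Du x t - Du y t) \<le> C * norm (x - y) powr (2 * \<alpha> - 1)"
      unfolding mem_Times_iff fst_conv snd_conv mem_cball_0 real_norm_def by blast
    show "\<exists>C\<ge>0. (\<forall>x t \<tau>. norm x \<le> R \<longrightarrow> \<bar>t\<bar> \<le> R \<longrightarrow> \<bar>\<tau>\<bar> \<le> R \<longrightarrow> \<bar>u x t - u x \<tau>\<bar> \<le> C * \<bar>t - \<tau>\<bar> powr \<alpha>) \<and>
      (\<forall>x y t. norm x \<le> R \<longrightarrow> norm y \<le> R \<longrightarrow> \<bar>t\<bar> \<le> R \<longrightarrow> norm (Du x t - Du y t) \<le> C * norm (x - y) powr (2 * \<alpha> - 1))"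
      using order_trans[OF C(1) abs] order_trans[OF C(2) abs] by (intro exI[of _ "\<bar>C\<bar>"]) auto
  qed
qed

text \<open>At a successor level the time derivative is continuous by induction, hence locally
  bounded, so \<open>u\<close> is locally Lipschitz in time; continuity in space comes from
  differentiability.\<close>

lemma hoelder_lev_imp_continuous:
  fixes u :: "'a::euclidean_space \<Rightarrow> real \<Rightarrow> real"
  assumes "hoelder_lev k \<alpha> u"
  shows "continuous_on UNIV (case_prod u)"
  using assms
proof (induction k arbitrary: \<alpha> u)
  case 0
  then have \<alpha>: "0 < \<alpha>" "hoelder_base \<alpha> u" by auto
  show ?case
  proof (cases "\<alpha> \<le> 1/2")
    case True
    note low = hoelder_base_low[OF \<alpha>(2) True]
    show ?thesis
    proof (rule time_hoelder_imp_continuous[OF \<alpha>(1)])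
      fix R :: real
      obtain C where C: "\<And>x t y \<tau>. norm x \<le> R \<Longrightarrow> \<bar>t\<bar> \<le> R \<Longrightarrow> norm y \<le> R \<Longrightarrow> \<bar>\<tau>\<bar> \<le> R \<Longrightarrow>
          \<bar>u x t - u y \<tau>\<bar> \<le> C * (norm (x - y) + sqrt \<bar>t - \<tau>\<bar>) powr (2 * \<alpha>)"
        using low[of R] by blast
      have "(sqrt \<bar>a\<bar>) powr (2 * \<alpha>) = \<bar>a\<bar> powr \<alpha>" for a :: real
        by (simp add: powr_half_sqrt[symmetric] powr_powr)
      then show "\<exists>C. \<forall>x t \<tau>. norm x \<le> R \<longrightarrow> \<bar>t\<bar> \<le> R \<longrightarrow> \<bar>\<tau>\<bar> \<le> R \<longrightarrow> \<bar>u x t - u x \<tau>\<bar> \<le> C * \<bar>t - \<tau>\<bar> powr \<alpha>"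
        using C by (metis add_0 diff_self norm_zero)
    next
      fix x :: 'a and t :: real
      define R where "R = norm x + \<bar>t\<bar> + 1"
      obtain C where C: "\<And>x t y \<tau>. norm x \<le> R \<Longrightarrow> \<bar>t\<bar> \<le> R \<Longrightarrow> norm y \<le> R \<Longrightarrow> \<bar>\<tau>\<bar> \<le> R \<Longrightarrow>
          \<bar>u x t - u y \<tau>\<bar> \<le> C * (norm (x - y) + sqrt \<bar>t - \<tau>\<bar>) powr (2 * \<alpha>)"
        using low[of R] by blast
      have "((\<lambda>y. norm (y - x) powr (2 * \<alpha>)) \<longlongrightarrow> norm (x - x) powr (2 * \<alpha>)) (at x)"
        using \<alpha> by (intro tendsto_powr2 tendsto_intros) auto
      then have "((\<lambda>y. C * norm (y - x) powr (2 * \<alpha>)) \<longlongrightarrow> C * norm (x - x) powr (2 * \<alpha>)) (at x)"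
        by (rule tendsto_mult_left)
      then have g0: "((\<lambda>y. C * norm (y - x) powr (2 * \<alpha>)) \<longlongrightarrow> 0) (at x)" using \<alpha> by simp
      have "eventually (\<lambda>y. dist y x < 1) (at x)"
        by (auto simp: eventually_at intro: exI[of _ 1])
      then have "eventually (\<lambda>y. norm (u y t - u x t) \<le> C * norm (y - x) powr (2 * \<alpha>)) (at x)"
      proof eventually_elim
        case (elim y)
        then have "norm y \<le> R"
          using norm_triangle_ineq2[of y x] unfolding R_def dist_norm by linarith
        then show ?case using C[of y t x t] by (simp add: R_def)
      qed
      then have "((\<lambda>y. u y t - u x t) \<longlongrightarrow> 0) (at x)"
        by (rule Lim_null_comparison) (rule g0)
      then show "isCont (\<lambda>x. u x t) x" by (simp add: isCont_def LIM_zero_iff)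
    qed
  next
    case False
    then obtain Du :: "'a \<Rightarrow> real \<Rightarrow> 'a" where
      D: "\<And>x t. ((\<lambda>y. u y t) has_derivative (\<lambda>h. Du x t \<bullet> h)) (at x)" and
      H: "\<And>R. \<exists>C\<ge>0. (\<forall>x t \<tau>. norm x \<le> R \<longrightarrow> \<bar>t\<bar> \<le> R \<longrightarrow> \<bar>\<tau>\<bar> \<le> R \<longrightarrow> \<bar>u x t - u x \<tau>\<bar> \<le> C * \<bar>t - \<tau>\<bar> powr \<alpha>) \<and>
        (\<forall>x y t. norm x \<le> R \<longrightarrow> norm y \<le> R \<longrightarrow> \<bar>t\<bar> \<le> R \<longrightarrow> norm (Du x t - Du y t) \<le> C * norm (x - y) powr (2 * \<alpha> - 1))"
      using hoelder_base_high[OF \<alpha>(2)] by (metis not_le)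
    show ?thesis
    proof (rule time_hoelder_imp_continuous[OF \<alpha>(1)])
      show "isCont (\<lambda>x. u x t) x" for x t using D[of t x] by (rule has_derivative_continuous)
    qed (use H in blast)
  qed
next
  case (Suc k)
  then obtain ut and Du :: "'a \<Rightarrow> real \<Rightarrow> 'a" where
    ut: "\<And>x t. ((\<lambda>\<tau>. u x \<tau>) has_real_derivative ut x t) (at t)" and
    D: "\<And>x t. ((\<lambda>y. u y t) has_derivative (\<lambda>h. Du x t \<bullet> h)) (at x)" and
    lev: "hoelder_lev k (\<alpha> - 1) ut"
    by auto
  show ?case
  proof (rule time_hoelder_imp_continuous[of 1])
    show "isCont (\<lambda>x. u x t) x" for x t using D[of t x] by (rule has_derivative_continuous)
    show "\<exists>C. \<forall>x t \<tau>. norm x \<le> R \<longrightarrow> \<bar>t\<bar> \<le> R \<longrightarrow> \<bar>\<tau>\<bar> \<le> R \<longrightarrow> \<bar>u x t - u x \<tau>\<bar> \<le> C * \<bar>t - \<tau>\<bar> powr 1" for R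
      by (rule time_derivative_imp_lipschitz[OF ut Suc.IH[OF lev]])
  qed simp
qed

section \<open>Second differences of Hoelder functions\<close>

lemma second_diff_mean_value:
  fixes f :: "'a::euclidean_space \<Rightarrow> real"
  assumes "\<And>x. (f has_derivative (\<lambda>h. Df x \<bullet> h)) (at x)"
  obtains \<theta> where "0 < \<theta>" "\<theta> < 1" "f (x + h) + f (x - h) - 2 * f x = (Df (x + \<theta> *\<^sub>R h) - Df (x - \<theta> *\<^sub>R h)) \<bullet> h"
proof -
  \<comment> \<open>The mean value theorem is applied to this even function of \<theta>, for which
    \<open>g 1 - g 0\<close> is the second difference.\<close>
  define g where "g \<theta> = f (x + \<theta> *\<^sub>R h) + f (x + (- \<theta>) *\<^sub>R h)" for \<theta> :: real
  have d1: "((\<lambda>\<theta>. f (x + (c * \<theta>) *\<^sub>R h)) has_real_derivative Df (x + (c * \<theta>) *\<^sub>R h) \<bullet> (c *\<^sub>R h)) (at \<theta>)" for c \<theta> :: real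
  proof -
    have "((\<lambda>\<theta>. x + (c * \<theta>) *\<^sub>R h) has_derivative (\<lambda>k. (c * k) *\<^sub>R h)) (at \<theta>)"
      by (auto intro!: derivative_eq_intros)
    from has_derivative_compose[OF this assms] show ?thesis
      unfolding has_field_derivative_def by (rule has_derivative_eq_rhs) (auto simp: mult_ac)
  qed
  have dg: "(g has_real_derivative (Df (x + \<theta> *\<^sub>R h) - Df (x - \<theta> *\<^sub>R h)) \<bullet> h) (at \<theta>)" for \<theta>
    unfolding g_def using DERIV_add[OF d1[of 1 \<theta>] d1[of "- 1" \<theta>]] by (simp add: inner_diff_left)
  obtain \<theta> where "0 < \<theta>" "\<theta> < 1" "g 1 - g 0 = (1 - 0) * ((Df (x + \<theta> *\<^sub>R h) - Df (x - \<theta> *\<^sub>R h)) \<bullet> h)"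
    using MVT2[of 0 1 g "\<lambda>\<theta>. (Df (x + \<theta> *\<^sub>R h) - Df (x - \<theta> *\<^sub>R h)) \<bullet> h"] dg by auto
  then show ?thesis by (intro that[of \<theta>]) (auto simp: g_def)
qed

lemma bilinear_entries_bound:
  fixes A :: "'a::euclidean_space \<Rightarrow> 'a"
  assumes "linear A" and B: "\<And>b c. b \<in> Basis \<Longrightarrow> c \<in> Basis \<Longrightarrow> \<bar>A b \<bullet> c\<bar> \<le> B"
  shows "\<bar>A h \<bullet> h\<bar> \<le> (real DIM('a))\<^sup>2 * B * (norm h)\<^sup>2"
proof -
  have "A h = (\<Sum>b\<in>Basis. (h \<bullet> b) *\<^sub>R A b)"
    using linear_sum[OF assms(1), of "\<lambda>b. (h \<bullet> b) *\<^sub>R b" Basis] linear_scale[OF assms(1)]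
    by (simp add: euclidean_representation)
  then have "A h \<bullet> h = (\<Sum>c\<in>Basis. \<Sum>b\<in>Basis. (h \<bullet> b) * (A b \<bullet> c) * (h \<bullet> c))"
    by (subst euclidean_inner) (simp add: inner_sum_left sum_distrib_right)
  also have "\<bar>\<dots>\<bar> \<le> (\<Sum>c\<in>Basis. \<bar>\<Sum>b\<in>Basis. (h \<bullet> b) * (A b \<bullet> c) * (h \<bullet> c)\<bar>)" by (rule sum_abs)
  also have "\<dots> \<le> (\<Sum>c\<in>(Basis::'a set). \<Sum>b\<in>(Basis::'a set). norm h * B * norm h)"
  proof (intro sum_mono order_trans[OF sum_abs])
    fix b c :: 'a assume bc: "b \<in> Basis" "c \<in> Basis"
    have "\<bar>h \<bullet> b\<bar> * \<bar>A b \<bullet> c\<bar> * \<bar>h \<bullet> c\<bar> \<le> norm h * B * norm h"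
      using bc B[OF bc] Basis_le_norm[OF bc(1), of h] Basis_le_norm[OF bc(2), of h]
      by (intro mult_mono mult_nonneg_nonneg) auto
    then show "\<bar>(h \<bullet> b) * (A b \<bullet> c) * (h \<bullet> c)\<bar> \<le> norm h * B * norm h" by (simp add: abs_mult)
  qed
  also have "\<dots> = (real DIM('a))\<^sup>2 * B * (norm h)\<^sup>2" by (simp add: power2_eq_square)
  finally show ?thesis .
qed

text \<open>One estimate for the three regimes. For \<open>\<alpha> \<le> 1/2\<close> it is the
  Hoelder bound itself, for \<open>1/2 < \<alpha> \<le> 1\<close> the gradient contributes the power
  \<open>2 * \<alpha> - 1\<close> and the mean value theorem one more factor \<open>norm h\<close>;
  in both cases \<beta> = \<alpha>. At higher levels the second derivatives are locally bounded and
  \<beta> = 1, which exceeds \<open>s\<close>.\<close>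

lemma hoelder_lev_second_diff:
  fixes u :: "'a::euclidean_space \<Rightarrow> real \<Rightarrow> real"
  assumes lev: "hoelder_lev k \<alpha> u" and s: "s < \<alpha>" "s < 1"
  obtains \<beta> where "s < \<beta>" "\<beta> \<le> 1" "0 < \<beta>"
    "\<And>R. \<exists>C\<ge>0. \<forall>x t h r. norm x \<le> R \<longrightarrow> \<bar>t\<bar> \<le> R \<longrightarrow> norm h \<le> 1 \<longrightarrow> 0 \<le> r \<longrightarrow> r \<le> 1 \<longrightarrow>
      \<bar>u (x + h) (t - r) + u (x - h) (t - r) - 2 * u x t\<bar> \<le> C * (norm h powr (2 * \<beta>) + r powr \<beta>)"
proof -
  \<comment> \<open>The second difference is taken at the single time \<open>t - r\<close>; twice
    the time increment at \<open>x\<close> makes up for the rest.\<close>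
  have split: "\<bar>u (x + h) (t - r) + u (x - h) (t - r) - 2 * u x t\<bar> \<le> C * (norm h powr (2 * \<beta>) + r powr \<beta>)"
    if "\<bar>u (x + h) (t - r) + u (x - h) (t - r) - 2 * u x (t - r)\<bar> \<le> C1 * norm h powr (2 * \<beta>)"
      and "\<bar>u x (t - r) - u x t\<bar> \<le> C2 * r powr \<beta>"
      and "C = \<bar>C1\<bar> + 2 * \<bar>C2\<bar>" for x t h r \<beta> C1 C2 C
  proof -
    have "C1 * norm h powr (2 * \<beta>) \<le> C * norm h powr (2 * \<beta>)" "2 * C2 * r powr \<beta> \<le> C * r powr \<beta>"
      using that(3) by (auto intro!: mult_right_mono)
    then show ?thesis using that(1,2) by (simp add: algebra_simps)
  qed
  show ?thesis
  proof (cases k)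
    case 0
    with lev have \<alpha>: "0 < \<alpha>" "\<alpha> \<le> 1" "hoelder_base \<alpha> u" by auto
    show ?thesis
    proof (rule that[OF s(1) \<alpha>(2) \<alpha>(1)])
      fix R :: real
      show "\<exists>C\<ge>0. \<forall>x t h r. norm x \<le> R \<longrightarrow> \<bar>t\<bar> \<le> R \<longrightarrow> norm h \<le> 1 \<longrightarrow> 0 \<le> r \<longrightarrow> r \<le> 1 \<longrightarrow>
        \<bar>u (x + h) (t - r) + u (x - h) (t - r) - 2 * u x t\<bar> \<le> C * (norm h powr (2 * \<alpha>) + r powr \<alpha>)"
      proof (cases "\<alpha> \<le> 1/2")
        case True
        \<comment> \<open>The box of radius \<open>R + 1\<close> contains the displaced points and
          times, as \<open>norm h\<close> and \<open>r\<close> are at most 1.\<close>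
        obtain C where C: "0 \<le> C" "\<And>x t y \<tau>. norm x \<le> R + 1 \<Longrightarrow> \<bar>t\<bar> \<le> R + 1 \<Longrightarrow> norm y \<le> R + 1 \<Longrightarrow> \<bar>\<tau>\<bar> \<le> R + 1 \<Longrightarrow>
          \<bar>u x t - u y \<tau>\<bar> \<le> C * (norm (x - y) + sqrt \<bar>t - \<tau>\<bar>) powr (2 * \<alpha>)"
          using hoelder_base_low[OF \<alpha>(3) True, of "R + 1"] by blast
        have "\<bar>u (x + h) (t - r) + u (x - h) (t - r) - 2 * u x t\<bar> \<le> (4 * C) * (norm h powr (2 * \<alpha>) + r powr \<alpha>)"
          if a: "norm x \<le> R" "\<bar>t\<bar> \<le> R" "norm h \<le> 1" "0 \<le> r" "r \<le> 1" for x t h r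
        proof -
          \<comment> \<open>The sum is at most twice its larger term, and
            \<open>2 powr (2 * \<alpha>) \<le> 2\<close> because \<open>\<alpha> \<le> 1/2\<close>.
            Two displaced points then give the factor 4 in \<open>4 * C\<close>.\<close>
          have sub: "(norm h + sqrt r) powr (2 * \<alpha>) \<le> 2 * (norm h powr (2 * \<alpha>) + r powr \<alpha>)"
          proof -
            define m where "m = max (norm h) (sqrt r)"
            have m: "m powr (2 * \<alpha>) \<le> norm h powr (2 * \<alpha>) + r powr \<alpha>"
              using a by (auto simp: m_def max_def powr_half_sqrt[symmetric] powr_powr)
            have "(norm h + sqrt r) powr (2 * \<alpha>) \<le> (2 * m) powr (2 * \<alpha>)"
              using \<alpha> a by (intro powr_mono2) (auto simp: m_def)
            also have "\<dots> = 2 powr (2 * \<alpha>) * m powr (2 * \<alpha>)"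
              using a by (simp add: powr_mult m_def max_def)
            also have "\<dots> \<le> 2 powr 1 * m powr (2 * \<alpha>)"
              using True by (intro mult_right_mono powr_mono) auto
            finally show ?thesis using m by simp
          qed
          have "\<bar>u (x + h') (t - r) - u x t\<bar> \<le> C * (norm h' + sqrt r) powr (2 * \<alpha>)" if "norm h' \<le> 1" for h'
            using C(2)[of "x + h'" "t - r" x t] that a norm_triangle_ineq[of x h'] by simp
          from this[of h] this[of "- h"] a(3)
          have "\<bar>u (x + h) (t - r) + u (x - h) (t - r) - 2 * u x t\<bar> \<le> 2 * (C * (norm h + sqrt r) powr (2 * \<alpha>))"
            by simp
          also have "\<dots> \<le> 2 * (C * (2 * (norm h powr (2 * \<alpha>) + r powr \<alpha>)))"
            using sub C(1) by (intro mult_left_mono) auto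
          finally show ?thesis by (simp add: algebra_simps)
        qed
        then show ?thesis using C(1) by (intro exI[of _ "4 * C"]) auto
      next
        case False
        then obtain Du :: "'a \<Rightarrow> real \<Rightarrow> 'a" where
          D: "\<And>x t. ((\<lambda>y. u y t) has_derivative (\<lambda>h. Du x t \<bullet> h)) (at x)" and
          H: "\<And>R. \<exists>C\<ge>0. (\<forall>x t \<tau>. norm x \<le> R \<longrightarrow> \<bar>t\<bar> \<le> R \<longrightarrow> \<bar>\<tau>\<bar> \<le> R \<longrightarrow> \<bar>u x t - u x \<tau>\<bar> \<le> C * \<bar>t - \<tau>\<bar> powr \<alpha>) \<and>
            (\<forall>x y t. norm x \<le> R \<longrightarrow> norm y \<le> R \<longrightarrow> \<bar>t\<bar> \<le> R \<longrightarrow> norm (Du x t - Du y t) \<le> C * norm (x - y) powr (2 * \<alpha> - 1))"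
          using hoelder_base_high[OF \<alpha>(3)] by (metis not_le)
        obtain C where C: "0 \<le> C"
          "\<And>x t \<tau>. norm x \<le> R + 1 \<Longrightarrow> \<bar>t\<bar> \<le> R + 1 \<Longrightarrow> \<bar>\<tau>\<bar> \<le> R + 1 \<Longrightarrow> \<bar>u x t - u x \<tau>\<bar> \<le> C * \<bar>t - \<tau>\<bar> powr \<alpha>"
          "\<And>x y t. norm x \<le> R + 1 \<Longrightarrow> norm y \<le> R + 1 \<Longrightarrow> \<bar>t\<bar> \<le> R + 1 \<Longrightarrow> norm (Du x t - Du y t) \<le> C * norm (x - y) powr (2 * \<alpha> - 1)"
          using H[of "R + 1"] by blast
        have "\<bar>u (x + h) (t - r) + u (x - h) (t - r) - 2 * u x t\<bar> \<le> (\<bar>2 * C\<bar> + 2 * \<bar>C\<bar>) * (norm h powr (2 * \<alpha>) + r powr \<alpha>)"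
          if a: "norm x \<le> R" "\<bar>t\<bar> \<le> R" "norm h \<le> 1" "0 \<le> r" "r \<le> 1" for x t h r
        proof (rule split[OF _ _ refl])
          show "\<bar>u x (t - r) - u x t\<bar> \<le> C * r powr \<alpha>" using C(2)[of x "t - r" t] a by simp
          obtain \<theta> where \<theta>: "0 < \<theta>" "\<theta> < 1" and
            e: "u (x + h) (t - r) + u (x - h) (t - r) - 2 * u x (t - r) = (Du (x + \<theta> *\<^sub>R h) (t - r) - Du (x - \<theta> *\<^sub>R h) (t - r)) \<bullet> h"
            using second_diff_mean_value[of "\<lambda>y. u y (t - r)" "\<lambda>y. Du y (t - r)" x h, OF D] by blast
          have \<theta>h: "\<theta> * norm h \<le> norm h" using \<theta> by (simp add: mult_le_cancel_right2)
          have n1: "norm (x + \<theta> *\<^sub>R h) \<le> R + 1" "norm (x - \<theta> *\<^sub>R h) \<le> R + 1"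
            using norm_triangle_ineq[of x "\<theta> *\<^sub>R h"] norm_triangle_ineq4[of x "\<theta> *\<^sub>R h"] \<theta> \<theta>h a by auto
          have "norm (Du (x + \<theta> *\<^sub>R h) (t - r) - Du (x - \<theta> *\<^sub>R h) (t - r))
              \<le> C * norm ((x + \<theta> *\<^sub>R h) - (x - \<theta> *\<^sub>R h)) powr (2 * \<alpha> - 1)"
            using C(3)[OF n1, of "t - r"] a by simp
          also have "(x + \<theta> *\<^sub>R h) - (x - \<theta> *\<^sub>R h) = (2 * \<theta>) *\<^sub>R h" by (simp add: algebra_simps flip: scaleR_add_left)
          \<comment> \<open>The two points are at most \<open>2 * norm h\<close> apart since
            \<open>\<theta> < 1\<close>; the factor \<open>2 powr (2 * \<alpha> - 1)\<close> is at
            most 2 since \<open>\<alpha> \<le> 1\<close>.\<close>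
          also have "C * norm ((2 * \<theta>) *\<^sub>R h) powr (2 * \<alpha> - 1) \<le> C * (2 * norm h) powr (2 * \<alpha> - 1)"
            using False \<theta> \<theta>h C by (intro mult_left_mono powr_mono2) auto
          also have "\<dots> = C * (2 powr (2 * \<alpha> - 1) * norm h powr (2 * \<alpha> - 1))"
            by (simp add: powr_mult)
          also have "\<dots> \<le> C * (2 powr 1 * norm h powr (2 * \<alpha> - 1))"
            using \<alpha> C by (intro mult_left_mono mult_right_mono powr_mono) auto
          finally have "norm (Du (x + \<theta> *\<^sub>R h) (t - r) - Du (x - \<theta> *\<^sub>R h) (t - r)) * norm h
              \<le> C * (2 powr 1 * norm h powr (2 * \<alpha> - 1)) * norm h"
            by (rule mult_right_mono) simp
          also have "\<dots> = 2 * C * (norm h powr (2 * \<alpha> - 1) * norm h powr 1)"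
            by simp
          also have "\<dots> = 2 * C * norm h powr (2 * \<alpha>)"
            by (simp only: powr_add[symmetric]) simp
          finally show "\<bar>u (x + h) (t - r) + u (x - h) (t - r) - 2 * u x (t - r)\<bar> \<le> 2 * C * norm h powr (2 * \<alpha>)"
            unfolding e using Cauchy_Schwarz_ineq2 order_trans by blast
        qed
        then show ?thesis by (intro exI[of _ "\<bar>2 * C\<bar> + 2 * \<bar>C\<bar>"]) auto
      qed
    qed
  next
    case (Suc j)
    with lev obtain ut and Du :: "'a \<Rightarrow> real \<Rightarrow> 'a" and D2 :: "'a \<Rightarrow> real \<Rightarrow> 'a \<Rightarrow> 'a" where
      ut: "\<And>x t. ((\<lambda>\<tau>. u x \<tau>) has_real_derivative ut x t) (at t)" and
      D: "\<And>x t. ((\<lambda>y. u y t) has_derivative (\<lambda>h. Du x t \<bullet> h)) (at x)" and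
      DD: "\<And>x t. ((\<lambda>y. Du y t) has_derivative D2 x t) (at x)" and
      lut: "hoelder_lev j (\<alpha> - 1) ut" and
      lD2: "\<And>b c. b \<in> Basis \<Longrightarrow> c \<in> Basis \<Longrightarrow> hoelder_lev j (\<alpha> - 1) (\<lambda>x t. D2 x t b \<bullet> c)"
      unfolding Suc hoelder_lev.simps by blast
    show ?thesis
    proof (rule that[OF s(2)])
      fix R :: real
      obtain C2 where C2: "\<And>x t \<tau>. norm x \<le> R + 1 \<Longrightarrow> \<bar>t\<bar> \<le> R + 1 \<Longrightarrow> \<bar>\<tau>\<bar> \<le> R + 1 \<Longrightarrow> \<bar>u x t - u x \<tau>\<bar> \<le> C2 * \<bar>t - \<tau>\<bar> powr 1"
        using time_derivative_imp_lipschitz[OF ut hoelder_lev_imp_continuous[OF lut], of "R + 1"] by blast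
      have "\<forall>b\<in>Basis. \<forall>c\<in>Basis. \<exists>B\<ge>0. \<forall>x t. norm x \<le> R + 1 \<longrightarrow> \<bar>t\<bar> \<le> R + 1 \<longrightarrow> \<bar>D2 x t b \<bullet> c\<bar> \<le> B"
        using continuous_bounded_on_box[OF hoelder_lev_imp_continuous[OF lD2]] by metis
      then obtain Bf where Bf: "\<And>b c. b \<in> Basis \<Longrightarrow> c \<in> Basis \<Longrightarrow> 0 \<le> Bf b c"
        "\<And>b c x t. b \<in> Basis \<Longrightarrow> c \<in> Basis \<Longrightarrow> norm x \<le> R + 1 \<Longrightarrow> \<bar>t\<bar> \<le> R + 1 \<Longrightarrow> \<bar>D2 x t b \<bullet> c\<bar> \<le> Bf b c"
        by metis
      define B where "B = (\<Sum>b\<in>Basis. \<Sum>c\<in>Basis. Bf b c)"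
      have Ble: "Bf b c \<le> B" if "b \<in> Basis" "c \<in> Basis" for b c
      proof -
        have "Bf b c \<le> (\<Sum>c\<in>Basis. Bf b c)"
          using that Bf by (intro member_le_sum) auto
        also have "\<dots> \<le> B"
          unfolding B_def using that Bf by (intro member_le_sum) (auto intro!: sum_nonneg)
        finally show ?thesis .
      qed
      have B0: "0 \<le> B" unfolding B_def using Bf by (auto intro!: sum_nonneg)
      define C1 where "C1 = 2 * ((real DIM('a))\<^sup>2 * B)"
      have "\<bar>u (x + h) (t - r) + u (x - h) (t - r) - 2 * u x t\<bar> \<le> (\<bar>C1\<bar> + 2 * \<bar>C2\<bar>) * (norm h powr (2 * 1) + r powr 1)"
        if a: "norm x \<le> R" "\<bar>t\<bar> \<le> R" "norm h \<le> 1" "0 \<le> r" "r \<le> 1" for x t h r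
      proof (rule split[OF _ _ refl])
        show "\<bar>u x (t - r) - u x t\<bar> \<le> C2 * r powr 1" using C2[of x "t - r" t] a by simp
        obtain \<theta> where \<theta>: "0 < \<theta>" "\<theta> < 1" and
          e: "u (x + h) (t - r) + u (x - h) (t - r) - 2 * u x (t - r) = (Du (x + \<theta> *\<^sub>R h) (t - r) - Du (x - \<theta> *\<^sub>R h) (t - r)) \<bullet> h"
          using second_diff_mean_value[of "\<lambda>y. u y (t - r)" "\<lambda>y. Du y (t - r)" x h, OF D] by blast
        define g where "g \<sigma> = Du (x + \<sigma> *\<^sub>R h) (t - r) \<bullet> h" for \<sigma> :: real
        have dg: "(g has_real_derivative D2 (x + \<sigma> *\<^sub>R h) (t - r) h \<bullet> h) (at \<sigma>)" for \<sigma>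
        proof -
          have "((\<lambda>\<sigma>. x + \<sigma> *\<^sub>R h) has_derivative (\<lambda>k. k *\<^sub>R h)) (at \<sigma>)"
            by (auto intro!: derivative_eq_intros)
          then have "((\<lambda>\<sigma>. Du (x + \<sigma> *\<^sub>R h) (t - r)) has_derivative (\<lambda>k. D2 (x + \<sigma> *\<^sub>R h) (t - r) (k *\<^sub>R h))) (at \<sigma>)"
            by (rule has_derivative_compose[OF _ DD])
          from has_derivative_inner_left[OF this, of h]
          show ?thesis unfolding has_field_derivative_def g_def
            by (rule has_derivative_eq_rhs)
               (simp add: linear_scale[OF has_derivative_linear[OF DD]] mult.commute fun_eq_iff)
        qed
        \<comment> \<open>A second mean value theorem, on an interval of length
          \<open>2 * \<theta> \<le> 2\<close>, which is the source of the factor 2 in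
          \<open>C1\<close>.\<close>
        obtain \<sigma> where \<sigma>: "- \<theta> < \<sigma>" "\<sigma> < \<theta>" and eg: "g \<theta> - g (- \<theta>) = (\<theta> - - \<theta>) * (D2 (x + \<sigma> *\<^sub>R h) (t - r) h \<bullet> h)"
          using MVT2[of "- \<theta>" \<theta> g "\<lambda>\<sigma>. D2 (x + \<sigma> *\<^sub>R h) (t - r) h \<bullet> h"] dg \<theta> by auto
        have "\<bar>\<sigma>\<bar> * norm h \<le> 1 * 1" using \<sigma> \<theta> a by (intro mult_mono) auto
        then have "norm (x + \<sigma> *\<^sub>R h) \<le> R + 1"
          using norm_triangle_ineq[of x "\<sigma> *\<^sub>R h"] a by simp
        then have "\<bar>D2 (x + \<sigma> *\<^sub>R h) (t - r) h \<bullet> h\<bar> \<le> (real DIM('a))\<^sup>2 * B * (norm h)\<^sup>2"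
          using a order_trans[OF Bf(2) Ble] has_derivative_linear[OF DD]
          by (intro bilinear_entries_bound) auto
        then have "2 * \<theta> * \<bar>D2 (x + \<sigma> *\<^sub>R h) (t - r) h \<bullet> h\<bar> \<le> 2 * ((real DIM('a))\<^sup>2 * B * (norm h)\<^sup>2)"
          using \<theta> by (intro mult_mono) auto
        moreover have "u (x + h) (t - r) + u (x - h) (t - r) - 2 * u x (t - r) = 2 * \<theta> * (D2 (x + \<sigma> *\<^sub>R h) (t - r) h \<bullet> h)"
          unfolding e using eg by (simp add: g_def inner_diff_left)
        ultimately show "\<bar>u (x + h) (t - r) + u (x - h) (t - r) - 2 * u x (t - r)\<bar> \<le> C1 * norm h powr (2 * 1)"
          using \<theta> by (simp add: abs_mult C1_def mult.assoc)
      qed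
      then show "\<exists>C\<ge>0. \<forall>x t h r. norm x \<le> R \<longrightarrow> \<bar>t\<bar> \<le> R \<longrightarrow> norm h \<le> 1 \<longrightarrow> 0 \<le> r \<longrightarrow> r \<le> 1 \<longrightarrow>
        \<bar>u (x + h) (t - r) + u (x - h) (t - r) - 2 * u x t\<bar> \<le> C * (norm h powr (2 * 1) + r powr 1)"
        by (intro exI[of _ "\<bar>C1\<bar> + 2 * \<bar>C2\<bar>"]) auto
    qed auto
  qed
qed

theorem theorem1p4:
  fixes u :: "'a::euclidean_space \<Rightarrow> real \<Rightarrow> real" and s :: real
  assumes "0 < s" and "s < 1"
    and "\<exists>\<epsilon>>0. hoelder_loc (s + \<epsilon>) u"
    and "\<exists>M. \<forall>x t. \<bar>u x t\<bar> \<le> M"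
    and "\<forall>x t. frac_heat s u x t = 0"
  shows "\<exists>c. \<forall>x t. u x t = c"
proof -
  obtain M where M: "\<And>x t. \<bar>u x t\<bar> \<le> M" using assms(4) by blast
  obtain \<epsilon> where "0 < \<epsilon>" "hoelder_loc (s + \<epsilon>) u" using assms(3) by blast
  then obtain k \<alpha> where lev: "hoelder_lev k \<alpha> u" and \<alpha>: "s < \<alpha>"
    unfolding hoelder_loc_def by (metis less_add_same_cancel1)
  define U where "U = case_prod u"
  have MU: "\<bar>U X\<bar> \<le> M" for X using M by (cases X) (simp add: U_def)
  have M0: "0 \<le> M" using M[of 0 0] by linarith
  have cont: "continuous_on UNIV U"
    unfolding U_def by (rule hoelder_lev_imp_continuous[OF lev])
  then have Um: "U \<in> borel_measurable borel" by (rule borel_measurable_continuous_onI)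
  \<comment> \<open>The nonzero prefactor cancels, so the vanishing of the operator passes to the
    jump integral.\<close>
  have eq: "(LINT r|lborel. jump s r * heat_defect U X r) = 0" for X
    using frac_heat_eq_jump_integral[OF Um[unfolded U_def] M, of s "fst X" "snd X"]
      assms(5) frac_heat_const_nonzero[OF assms(1,2)] by (simp add: U_def)
  obtain \<beta> where \<beta>: "s < \<beta>" "\<beta> \<le> 1" "0 < \<beta>" and
    sd: "\<And>R. \<exists>C\<ge>0. \<forall>x t h r. norm x \<le> R \<longrightarrow> \<bar>t\<bar> \<le> R \<longrightarrow> norm h \<le> 1 \<longrightarrow> 0 \<le> r \<longrightarrow> r \<le> 1 \<longrightarrow>
      \<bar>u (x + h) (t - r) + u (x - h) (t - r) - 2 * u x t\<bar> \<le> C * (norm h powr (2 * \<beta>) + r powr \<beta>)"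
    using hoelder_lev_second_diff[OF lev \<alpha> assms(2)] by blast
  have loc: "\<exists>C\<ge>0. \<forall>Y\<in>cball X \<delta>. \<forall>r>0. \<bar>heat_defect U Y r\<bar> \<le> C * r powr \<beta>" for X \<delta>
  proof -
    define R where "R = norm X + \<delta>"
    obtain C where C: "0 \<le> C" "\<And>x t h r. norm x \<le> R \<Longrightarrow> \<bar>t\<bar> \<le> R \<Longrightarrow> norm h \<le> 1 \<Longrightarrow> 0 \<le> r \<Longrightarrow> r \<le> 1 \<Longrightarrow>
      \<bar>u (x + h) (t - r) + u (x - h) (t - r) - 2 * u x t\<bar> \<le> C * (norm h powr (2 * \<beta>) + r powr \<beta>)"
      using sd[of R] by blast
    define G where "G = (LINT w|lborel. (2 + (norm w)\<^sup>2) * gauss (w::'a))"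
    \<comment> \<open>The summand \<open>4 * M\<close> covers \<open>norm h > 1\<close> or
      \<open>r > 1\<close>: there the sum of powers is at least 1, and boundedness limits the second
      difference to \<open>4 * M\<close>.\<close>
    have "\<bar>heat_defect U Y r\<bar> \<le> (C + 4 * M) * G * r powr \<beta>" if Y: "Y \<in> cball X \<delta>" and r: "0 < r" for Y r
    proof -
      obtain x t where xt: "Y = (x, t)" by (cases Y)
      have "norm Y \<le> R" using Y norm_triangle_ineq2[of Y X] by (simp add: R_def dist_norm norm_minus_commute)
      then have R: "norm x \<le> R" "\<bar>t\<bar> \<le> R"
        using norm_fst_le[of x t] norm_snd_le[of t x] unfolding xt by auto
      show ?thesis unfolding xt G_def
      proof (rule heat_defect_le_powr[OF Um MU \<beta>(3,2) _ r])
        fix h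
        show "\<bar>U (x + h, t - r) + U (x - h, t - r) - 2 * U (x, t)\<bar> \<le> (C + 4 * M) * (norm h powr (2 * \<beta>) + r powr \<beta>)"
        proof (cases "norm h \<le> 1 \<and> r \<le> 1")
          case True
          then have "\<bar>U (x + h, t - r) + U (x - h, t - r) - 2 * U (x, t)\<bar> \<le> C * (norm h powr (2 * \<beta>) + r powr \<beta>)"
            using C(2)[OF R, of h r] r by (simp add: U_def)
          also have "\<dots> \<le> (C + 4 * M) * (norm h powr (2 * \<beta>) + r powr \<beta>)"
            using M0 by (intro mult_right_mono) auto
          finally show ?thesis .
        next
          case False
          then have "1 \<le> norm h powr (2 * \<beta>) \<or> 1 \<le> r powr \<beta>"
            using \<beta> ge_one_powr_ge_zero[of "norm h" "2 * \<beta>"] ge_one_powr_ge_zero[of r \<beta>] by auto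
          then have ge: "1 \<le> norm h powr (2 * \<beta>) + r powr \<beta>"
            using powr_ge_zero[of "norm h" "2 * \<beta>"] powr_ge_zero[of r \<beta>] by linarith
          have "\<bar>U (x + h, t - r) + U (x - h, t - r) - 2 * U (x, t)\<bar> \<le> (C + 4 * M) * 1"
            using MU[of "(x + h, t - r)"] MU[of "(x - h, t - r)"] MU[of "(x, t)"] C(1) by simp
          also have "\<dots> \<le> (C + 4 * M) * (norm h powr (2 * \<beta>) + r powr \<beta>)"
            using ge C(1) M0 by (intro mult_left_mono) auto
          finally show ?thesis .
        qed
      qed (use C M0 in auto)
    qed
    moreover have "0 \<le> (C + 4 * M) * G" using C M0 by (simp add: G_def)
    ultimately show ?thesis by blast
  qed
  have "U (x, t) = U (0, 0)" for x t
    by (rule liouville_heat_defect[OF assms(1,2) \<beta>(1) cont MU loc eq])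
  then show ?thesis by (auto simp: U_def)
qed

end
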